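(* Let $F:\mathcal{P}(\mathcal{X})\times\mathcal{P}(\mathcal{Y})\to\mathbb{R}$ and $\sigma>0$. Assume: (i) (Bounded first-order flat derivatives) $F$ admits first-order flat derivatives with respect to both $\nu$ and $\mu$, and there exist constants $C_\nu,C_\mu>0$ such that for all $(\nu,\mu)\in\mathcal{P}(\mathcal{X})\times\mathcal{P}(\mathcal{Y})$ and all $(x,y)\in\mathcal{X}\times\mathcal{Y}$, $\left|\frac{\delta F}{\delta\nu}(\nu,\mu,x)\right|\le C_\nu$ and $\left|\frac{\delta F}{\delta\mu}(\nu,\mu,y)\right|\le C_\mu$. (ii) (Bounded second-order flat derivatives) $F$ admits second-order flat derivatives, and there exist constants $C_{\nu,\nu},C_{\mu,\mu},C_{\nu,\mu},C_{\mu,\nu}>0$ such that for all $(\nu,\mu)\in\mathcal{P}(\mathcal{X})\times\mathcal{P}(\mathcal{Y})$ and all $(x,y),(x',y')\in\mathcal{X}\times\mathcal{Y}$, $\left|\frac{\delta^2F}{\delta\nu^2}(\nu,\mu,x,x')\right|\le C_{\nu,\nu}$, $\left|\frac{\delta^2F}{\delta\mu^2}(\nu,\mu,y,y')\right|\le C_{\mu,\mu}$, $\left|\frac{\delta^2F}{\delta\nu\delta\mu}(\nu,\mu,y,x)\right|\le C_{\nu,\mu}$, $\left|\frac{\delta^2F}{\delta\mu\delta\nu}(\nu,\mu,x,y)\right|\le C_{\mu,\nu}$. (iii) (Ratio condition) $(\nu_0,\mu_0)\in\mathcal{P}(\mathcal{X})\times\mathcal{P}(\mathcal{Y})$ are absolutely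 continuous and comparable with $\pi$ and $\rho$: there exist constants $r_\nu,r_\mu>0$ and $R_\nu,R_\mu>1$ such that $$r_\nu\le\inf_{x\in\mathcal{X}}\frac{\nu_0(x)}{\pi(x)},\quad \sup_{x\in\mathcal{X}}\frac{\nu_0(x)}{\pi(x)}\le R_\nu,\quad r_\mu\le\inf_{y\in\mathcal{Y}}\frac{\mu_0(y)}{\rho(y)},\quad \sup_{y\in\mathcal{Y}}\frac{\mu_0(y)}{\rho(y)}\le R_\mu.$$ Let $(\nu_t,\mu_t)_{t\ge0}$ be the Fisher-Rao flow, i.e. the unique solution in $\mathcal{P}_{\text{ac}}(\mathcal{X})\times\mathcal{P}_{\text{ac}}(\mathcal{Y})$, started at $(\nu_0,\mu_0)$, of $$\begin{cases}\partial_t\nu_t(x)=-a(\nu_t,\mu_t,x)\,\nu_t(x),\\ \partial_t\mu_t(y)=b(\nu_t,\mu_t,y)\,\mu_t(y),\end{cases}$$ where $a(\nu,\mu,x)=\frac{\delta F}{\delta\nu}(\nu,\mu,x)+\frac{\sigma^2}{2}\log\left(\frac{\nu(x)}{\pi(x)}\right)-\frac{\sigma^2}{2}\mathrm{D_{KL}}(\nu|\pi)$ and $b(\nu,\mu,y)=\frac{\delta F}{\delta\mu}(\nu,\mu,y)-\frac{\sigma^2}{2}\log\left(\frac{\mu(y)}{\rho(y)}\right)+\frac{\sigma^2}{2}\mathrm{D_{KL}}(\mu|\rho)$. Let $(\nu,\mu)\in\mathcal{P}_{\text{ac}}(\mathcal{X})\times\mathcal{P}_{\text{ac}}(\mathcal{Y})$.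 Then the map $t\mapsto\mathrm{D_{KL}}(\nu|\nu_t)+\mathrm{D_{KL}}(\mu|\mu_t)$ is differentiable. Suppose furthermore that $F$ is convex in $\nu$ and concave in $\mu$, in the sense that for all $\nu,\nu'\in\mathcal{P}(\mathcal{X})$ and $\mu,\mu'\in\mathcal{P}(\mathcal{Y})$, $$F(\nu',\mu)-F(\nu,\mu)\ge\int_{\mathcal{X}}\frac{\delta F}{\delta\nu}(\nu,\mu,x)(\nu'-\nu)(\mathrm{d}x),\qquad F(\nu,\mu')-F(\nu,\mu)\le\int_{\mathcal{Y}}\frac{\delta F}{\delta\mu}(\nu,\mu,y)(\mu'-\mu)(\mathrm{d}y).$$ Let $(\nu_\sigma^*,\mu_\sigma^* )$ be the unique mixed Nash equilibrium of $V^\sigma$. Then for all $t>0$, $$\mathrm{D_{KL}}(\nu_\sigma^*|\nu_t)+\mathrm{D_{KL}}(\mu_\sigma^*|\mu_t)\le e^{-\frac{\sigma^2}{2}t}\left(\mathrm{D_{KL}}(\nu_\sigma^*|\nu_0)+\mathrm{D_{KL}}(\mu_\sigma^*|\mu_0)\right),$$ $$\mathrm{NI}(\nu_t,\mu_t)\le 2C_\sigma e^{-\frac{\sigma^2}{4}t}\sqrt{\mathrm{D_{KL}}(\nu_\sigma^*|\nu_0)+\mathrm{D_{KL}}(\mu_\sigma^*|\mu_0)},$$ where $C_\sigma:=\max\{C_{1,\sigma},C_{2,\sigma}\}$ and $C_{1,\sigma},C_{2,\sigma}>0$ are constants (which exist, and may depend on $\sigma$ but not on $t$) such that $|a(\nu_t,\mu,x)|\le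 C_{1,\sigma}$ and $|b(\nu,\mu_t,y)|\le C_{2,\sigma}$ for all $t\geq 0$, all $(\nu,\mu)\in\mathcal{P}(\mathcal{X})\times\mathcal{P}(\mathcal{Y})$ and all $(x,y)\in\mathcal{X}\times\mathcal{Y}$.
   Context: Setting. $\mathcal{X},\mathcal{Y}\subseteq\mathbb{R}^d$. $\mathcal{P}(\mathcal{Z})$ is the set of probability measures on $\mathcal{Z}$ and $\mathcal{P}_{\text{ac}}(\mathcal{Z})$ the subset of those absolutely continuous with respect to Lebesgue measure; the same symbol denotes such a measure and its density. $\pi(\mathrm{d}x)\propto e^{-U^\pi(x)}\mathrm{d}x\in\mathcal{P}_{\text{ac}}(\mathcal{X})$ and $\rho(\mathrm{d}y)\propto e^{-U^\rho(y)}\mathrm{d}y\in\mathcal{P}_{\text{ac}}(\mathcal{Y})$ are fixed reference probability measures, with $U^\pi:\mathcal{X}\to\mathbb{R}$, $U^\rho:\mathcal{Y}\to\mathbb{R}$ measurable. $\mathrm{D_{KL}}(\nu|\pi)=\int_{\mathcal{X}}\log\left(\frac{\nu(x)}{\pi(x)}\right)\nu(x)\mathrm{d}x$ if $\nu$ is absolutely continuous with respect to $\pi$, and $+\infty$ otherwise; similarly for other pairs of measures. Game. $V^\sigma(\nu,\mu):=F(\nu,\mu)+\frac{\sigma^2}{2}\left(\mathrm{D_{KL}}(\nu|\pi)-\mathrm{D_{KL}}(\mu|\rho)\right)$. A mixed Nash equilibrium (MNE) of $V^\sigma$ is a pair $(\nu_\sigma^*,\mu_\sigma^* )\in\mathcal{P}(\mathcal{X})\times\mathcal{P}(\mathcal{Y})$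 with $V^\sigma(\nu_\sigma^*,\mu)\le V^\sigma(\nu_\sigma^*,\mu_\sigma^* )\le V^\sigma(\nu,\mu_\sigma^* )$ for all $(\nu,\mu)\in\mathcal{P}(\mathcal{X})\times\mathcal{P}(\mathcal{Y})$. Existence and uniqueness of the MNE is known from earlier work and is taken for granted, as is the fact that it satisfies $\nu_\sigma^*(x)\propto\exp\left(-\frac{2}{\sigma^2}\frac{\delta F}{\delta\nu}(\nu_\sigma^*,\mu_\sigma^*,x)-U^\pi(x)\right)$ and $\mu_\sigma^*(y)\propto\exp\left(\frac{2}{\sigma^2}\frac{\delta F}{\delta\mu}(\nu_\sigma^*,\mu_\sigma^*,y)-U^\rho(y)\right)$. The Nikaidò-Isoda error is $\mathrm{NI}(\nu,\mu):=\max_{\mu'\in\mathcal{P}(\mathcal{Y})}V^\sigma(\nu,\mu')-\min_{\nu'\in\mathcal{P}(\mathcal{X})}V^\sigma(\nu',\mu)$. Flat derivative. For $\mathcal{M}\subseteq\mathbb{R}^d$, a function $G:\mathcal{P}(\mathcal{M})\to\mathbb{R}$ admits a first-order flat derivative if there is a function $\frac{\delta G}{\delta m}:\mathcal{P}(\mathcal{M})\times\mathcal{M}\to\mathbb{R}$, jointly continuous (with the weak topology on $\mathcal{P}(\mathcal{M})$), bounded in $x$ for each fixed $m$, such that for all $m,m'\in\mathcal{P}(\mathcal{M})$, $G(m')-G(m)=\int_0^1\int_{\mathcal{M}}\frac{\delta G}{\delta m}(m+\varepsilon(m'-m),x)(m'-m)(\mathrm{d}x)\mathrm{d}\varepsilon$.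 It is unique up to an additive constant (depending on $m$), fixed by the convention $\int_{\mathcal{M}}\frac{\delta G}{\delta m}(m,x)m(\mathrm{d}x)=0$. For $F(\nu,\mu)$, $\frac{\delta F}{\delta\nu}(\nu,\mu,x)$ and $\frac{\delta F}{\delta\mu}(\nu,\mu,y)$ are the flat derivatives in one variable with the other fixed. Second-order flat derivatives are flat derivatives of first-order ones at a fixed point: $\frac{\delta^2F}{\delta\nu^2}(\nu,\mu,x,x')$ is the flat derivative in $\nu$ (evaluated at $x'$) of $\nu\mapsto\frac{\delta F}{\delta\nu}(\nu,\mu,x)$; $\frac{\delta^2F}{\delta\mu\delta\nu}(\nu,\mu,x,y)$ is the flat derivative in $\mu$ (at $y$) of $\mu\mapsto\frac{\delta F}{\delta\nu}(\nu,\mu,x)$; $\frac{\delta^2F}{\delta\nu\delta\mu}(\nu,\mu,y,x)$ is the flat derivative in $\nu$ (at $x$) of $\nu\mapsto\frac{\delta F}{\delta\mu}(\nu,\mu,y)$; $\frac{\delta^2F}{\delta\mu^2}(\nu,\mu,y,y')$ is defined analogously. Known facts on the flow. Under (i)-(iii) the flow exists, is unique, and is continuous and differentiable in time (pointwise for densities); moreover $\mathrm{D_{KL}}(\nu_t|\pi)\le2\log R_\nu+\frac{4}{\sigma^2}C_\nu$, $\mathrm{D_{KL}}(\mu_t|\rho)\le2\log R_\mu+\frac{4}{\sigma^2}C_\mu$, and the ratios $\nu_t/\pi$ and $\mu_t/\rho$ are bounded above and below by positive constants uniformly in $t$ and in the space variable.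
   Formalization: Differentiability is claimed for those absolutely continuous (ν,μ) whose sum of divergences is finite at t=0 (then it is finite for all t≥0); otherwise the sum is shown to be +∞ for all t (e.g. ν Cauchy, π Gaussian), where differentiability has no meaning. *)

theory Defs
  imports "HOL-Probability.Probability"
begin

definition prob_on :: "'a::euclidean_space set \<Rightarrow> 'a measure set" where
  "prob_on M = {m. prob_space m \<and> sets m = sets (restrict_space borel M)}"

definition prob_ac_on :: "'a::euclidean_space set \<Rightarrow> 'a measure set" where
  "prob_ac_on M = {m \<in> prob_on M. absolutely_continuous (restrict_space lborel M) m}"

text \<open>Where a statement is pointwise in the space variable, an absolutely continuous measure is
  given by an everywhere defined density \<open>f\<close>; \<open>dens_meas M f\<close> is the measure \<open>f(x) dx\<close> on \<open>M\<close>.\<close>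

definition dens_meas :: "'a::euclidean_space set \<Rightarrow> ('a \<Rightarrow> real) \<Rightarrow> 'a measure" where
  "dens_meas M f = density (restrict_space lborel M) (\<lambda>x. ennreal (f x))"

definition prob_density_on :: "'a::euclidean_space set \<Rightarrow> ('a \<Rightarrow> real) \<Rightarrow> bool" where
  "prob_density_on M f \<longleftrightarrow>
     f \<in> borel_measurable (restrict_space borel M) \<and> (\<forall>x\<in>M. 0 \<le> f x) \<and> prob_space (dens_meas M f)"

text \<open>If \<open>exp (- U)\<close> is not integrable on \<open>M\<close>, or \<open>M\<close> is a null set, then the normalising constant
  is \<open>0\<close>, the quotient is identically \<open>0\<close>, and \<^term>\<open>prob_density_on M (gibbs_density M U)\<close> is false.\<close>

definition gibbs_density :: "'a::euclidean_space set \<Rightarrow> ('a \<Rightarrow> real) \<Rightarrow> 'a \<Rightarrow> real" where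
  "gibbs_density M U x = exp (- U x) / (\<integral>z. exp (- U z) \<partial>(restrict_space lborel M))"

abbreviation gibbs :: "'a::euclidean_space set \<Rightarrow> ('a \<Rightarrow> real) \<Rightarrow> 'a measure" where
  "gibbs M U \<equiv> dens_meas M (gibbs_density M U)"

text \<open>\<open>KL \<nu> \<pi>\<close> is \<open>D\<^sub>K\<^sub>L(\<nu>|\<pi>)\<close>; the library function takes the reference measure first. For probability
  measures the negative part of \<open>log (d\<nu>/d\<pi>)\<close> is always \<open>\<nu>\<close>-integrable, so if the function is not
  integrable its integral is \<open>+\<infinity>\<close>, whereas the library function, a Bochner integral, would return \<open>0\<close>.\<close>

definition KL :: "'a measure \<Rightarrow> 'a measure \<Rightarrow> ereal" where
  "KL \<nu> \<pi> =
     (if absolutely_continuous \<pi> \<nu> \<and> integrable \<nu> (entropy_density (exp 1) \<pi> \<nu>)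
      then ereal (KL_divergence (exp 1) \<pi> \<nu>) else \<infinity>)"


text \<open>The weak topology is the initial topology of the maps \<open>m \<mapsto> \<integral> f dm\<close>, for \<open>f\<close> bounded and
  continuous on \<open>M\<close>.\<close>

definition weak_topology :: "'a::euclidean_space set \<Rightarrow> 'a measure topology" where
  "weak_topology M = topology_generated_by
     {{m \<in> prob_on M. (\<integral>x. f x \<partial>m) \<in> S} | (f :: 'a \<Rightarrow> real) S.
        continuous_on M f \<and> bounded (f ` M) \<and> open S}"

text \<open>\<open>mixture m m' \<epsilon>\<close> is the measure \<open>m + \<epsilon> (m' - m)\<close>, for \<open>\<epsilon>\<close> between \<open>0\<close> and \<open>1\<close>.\<close>

definition mixture :: "'a measure \<Rightarrow> 'a measure \<Rightarrow> real \<Rightarrow> 'a measure" where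
  "mixture m m' \<epsilon> = measure_of (space m) (sets m)
     (\<lambda>A. ennreal (1 - \<epsilon>) * emeasure m A + ennreal \<epsilon> * emeasure m' A)"

lemma emeasure_mixture:
  assumes "sets m' = sets m" and "A \<in> sets m"
  shows "emeasure (mixture m m' \<epsilon>) A = ennreal (1 - \<epsilon>) * emeasure m A + ennreal \<epsilon> * emeasure m' A"
proof (rule emeasure_measure_of[OF mixture_def])
  show "sets m \<subseteq> Pow (space m)" by (rule sets.space_closed)
  show "A \<in> sets (mixture m m' \<epsilon>)" using assms by (simp add: mixture_def)
  show "positive (sets (mixture m m' \<epsilon>))
      (\<lambda>A. ennreal (1 - \<epsilon>) * emeasure m A + ennreal \<epsilon> * emeasure m' A)"
    by (simp add: positive_def)
  show "countably_additive (sets (mixture m m' \<epsilon>))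
      (\<lambda>A. ennreal (1 - \<epsilon>) * emeasure m A + ennreal \<epsilon> * emeasure m' A)"
    unfolding countably_additive_def
  proof (intro allI impI)
    fix B :: "nat \<Rightarrow> 'a set"
    assume "range B \<subseteq> sets (mixture m m' \<epsilon>)" and d: "disjoint_family B"
    then have B: "range B \<subseteq> sets m" "range B \<subseteq> sets m'"
      using assms(1) by (simp_all add: mixture_def)
    show "(\<Sum>i. ennreal (1 - \<epsilon>) * emeasure m (B i) + ennreal \<epsilon> * emeasure m' (B i)) =
        ennreal (1 - \<epsilon>) * emeasure m (\<Union>i. B i) + ennreal \<epsilon> * emeasure m' (\<Union>i. B i)"
      by (subst suminf_add[symmetric]) (simp_all add: suminf_emeasure B d)
  qed
qed

text \<open>\<open>g m x\<close> is the flat derivative \<open>(\<delta>G/\<delta>m)(m, x)\<close>; the last clause is the normalisation that makes it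
  unique.\<close>

definition has_flat_derivative ::
    "'a::euclidean_space set \<Rightarrow> ('a measure \<Rightarrow> real) \<Rightarrow> ('a measure \<Rightarrow> 'a \<Rightarrow> real) \<Rightarrow> bool" where
  "has_flat_derivative M G g \<longleftrightarrow>
     continuous_map (prod_topology (weak_topology M) (top_of_set M)) euclideanreal (\<lambda>(m, x). g m x) \<and>
     (\<forall>m\<in>prob_on M. bounded (g m ` M)) \<and>
     (\<forall>m\<in>prob_on M. \<forall>m'\<in>prob_on M.
        ((\<lambda>\<epsilon>. (\<integral>x. g (mixture m m' \<epsilon>) x \<partial>m') - (\<integral>x. g (mixture m m' \<epsilon>) x \<partial>m))
           has_integral (G m' - G m)) {0..1}) \<and>
     (\<forall>m\<in>prob_on M. (\<integral>x. g m x \<partial>m) = 0)"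


text \<open>In \<^typ>\<open>ereal\<close>, \<open>\<infinity> - \<infinity> = \<infinity>\<close>. This value of \<open>game_value\<close>, taken when both divergences are infinite,
  affects neither the set of equilibria (both divergences of an equilibrium are finite, as comparison
  with \<open>\<pi>\<close> and \<open>\<rho>\<close> shows) nor \<open>nikaido_isoda\<close> at pairs with finite divergences.\<close>

definition game_value ::
    "('a measure \<Rightarrow> 'a measure \<Rightarrow> real) \<Rightarrow> 'a measure \<Rightarrow> 'a measure \<Rightarrow> real \<Rightarrow>
     'a measure \<Rightarrow> 'a measure \<Rightarrow> ereal" where
  "game_value F \<pi> \<rho> \<sigma> \<nu> \<mu> = ereal (F \<nu> \<mu>) + ereal (\<sigma>\<^sup>2 / 2) * (KL \<nu> \<pi> - KL \<mu> \<rho>)"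

definition mixed_nash ::
    "'a::euclidean_space set \<Rightarrow> 'a set \<Rightarrow> ('a measure \<Rightarrow> 'a measure \<Rightarrow> ereal) \<Rightarrow>
     'a measure \<Rightarrow> 'a measure \<Rightarrow> bool" where
  "mixed_nash X Y V \<nu>' \<mu>' \<longleftrightarrow>
     \<nu>' \<in> prob_on X \<and> \<mu>' \<in> prob_on Y \<and>
     (\<forall>\<nu>\<in>prob_on X. \<forall>\<mu>\<in>prob_on Y. V \<nu>' \<mu> \<le> V \<nu>' \<mu>' \<and> V \<nu>' \<mu>' \<le> V \<nu> \<mu>')"

definition nikaido_isoda ::
    "'a::euclidean_space set \<Rightarrow> 'a set \<Rightarrow> ('a measure \<Rightarrow> 'a measure \<Rightarrow> ereal) \<Rightarrow>
     'a measure \<Rightarrow> 'a measure \<Rightarrow> ereal" where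
  "nikaido_isoda X Y V \<nu> \<mu> = (SUP \<mu>'\<in>prob_on Y. V \<nu> \<mu>') - (INF \<nu>'\<in>prob_on X. V \<nu>' \<mu>)"

definition convex_concave ::
    "'a::euclidean_space set \<Rightarrow> 'a set \<Rightarrow> ('a measure \<Rightarrow> 'a measure \<Rightarrow> real) \<Rightarrow>
     ('a measure \<Rightarrow> 'a measure \<Rightarrow> 'a \<Rightarrow> real) \<Rightarrow> ('a measure \<Rightarrow> 'a measure \<Rightarrow> 'a \<Rightarrow> real) \<Rightarrow> bool" where
  "convex_concave X Y F F\<^sub>\<nu> F\<^sub>\<mu> \<longleftrightarrow>
     (\<forall>\<nu>\<in>prob_on X. \<forall>\<nu>'\<in>prob_on X. \<forall>\<mu>\<in>prob_on Y. \<forall>\<mu>'\<in>prob_on Y.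
        F \<nu>' \<mu> - F \<nu> \<mu> \<ge> (\<integral>x. F\<^sub>\<nu> \<nu> \<mu> x \<partial>\<nu>') - (\<integral>x. F\<^sub>\<nu> \<nu> \<mu> x \<partial>\<nu>) \<and>
        F \<nu> \<mu>' - F \<nu> \<mu> \<le> (\<integral>y. F\<^sub>\<mu> \<nu> \<mu> y \<partial>\<mu>') - (\<integral>y. F\<^sub>\<mu> \<nu> \<mu> y \<partial>\<mu>))"


text \<open>\<open>drift_a\<close> takes \<open>\<nu>\<close>, and \<open>drift_b\<close> takes \<open>\<mu>\<close>, as a density. \<^const>\<open>ln\<close> and
  \<^const>\<open>real_of_ereal\<close> have their intended values where the density is positive and the divergence finite.\<close>

definition drift_a ::
    "'a::euclidean_space set \<Rightarrow> ('a \<Rightarrow> real) \<Rightarrow> ('a measure \<Rightarrow> 'a measure \<Rightarrow> 'a \<Rightarrow> real) \<Rightarrow> real \<Rightarrow>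
     ('a \<Rightarrow> real) \<Rightarrow> 'a measure \<Rightarrow> 'a \<Rightarrow> real" where
  "drift_a X U\<^sub>\<pi> F\<^sub>\<nu> \<sigma> n \<mu> x =
     F\<^sub>\<nu> (dens_meas X n) \<mu> x + \<sigma>\<^sup>2 / 2 * ln (n x / gibbs_density X U\<^sub>\<pi> x)
       - \<sigma>\<^sup>2 / 2 * real_of_ereal (KL (dens_meas X n) (gibbs X U\<^sub>\<pi>))"

definition drift_b ::
    "'a::euclidean_space set \<Rightarrow> ('a \<Rightarrow> real) \<Rightarrow> ('a measure \<Rightarrow> 'a measure \<Rightarrow> 'a \<Rightarrow> real) \<Rightarrow> real \<Rightarrow>
     'a measure \<Rightarrow> ('a \<Rightarrow> real) \<Rightarrow> 'a \<Rightarrow> real" where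
  "drift_b Y U\<^sub>\<rho> F\<^sub>\<mu> \<sigma> \<nu> m y =
     F\<^sub>\<mu> \<nu> (dens_meas Y m) y - \<sigma>\<^sup>2 / 2 * ln (m y / gibbs_density Y U\<^sub>\<rho> y)
       + \<sigma>\<^sup>2 / 2 * real_of_ereal (KL (dens_meas Y m) (gibbs Y U\<^sub>\<rho>))"

text \<open>\<open>n t\<close> and \<open>m t\<close> are the densities of \<open>\<nu>\<^sub>t\<close> and \<open>\<mu>\<^sub>t\<close>; the time derivative at \<open>0\<close> is one-sided.\<close>

definition fisher_rao_flow ::
    "'a::euclidean_space set \<Rightarrow> 'a set \<Rightarrow> ('a \<Rightarrow> real) \<Rightarrow> ('a \<Rightarrow> real) \<Rightarrow>
     ('a measure \<Rightarrow> 'a measure \<Rightarrow> 'a \<Rightarrow> real) \<Rightarrow> ('a measure \<Rightarrow> 'a measure \<Rightarrow> 'a \<Rightarrow> real) \<Rightarrow> real \<Rightarrow>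
     (real \<Rightarrow> 'a \<Rightarrow> real) \<Rightarrow> (real \<Rightarrow> 'a \<Rightarrow> real) \<Rightarrow> bool" where
  "fisher_rao_flow X Y U\<^sub>\<pi> U\<^sub>\<rho> F\<^sub>\<nu> F\<^sub>\<mu> \<sigma> n m \<longleftrightarrow>
     (\<forall>t\<ge>0. prob_density_on X (n t) \<and> prob_density_on Y (m t)) \<and>
     (\<forall>t\<ge>0. \<forall>x\<in>X. ((\<lambda>s. n s x) has_real_derivative
        - drift_a X U\<^sub>\<pi> F\<^sub>\<nu> \<sigma> (n t) (dens_meas Y (m t)) x * n t x) (at t within {0..})) \<and>
     (\<forall>t\<ge>0. \<forall>y\<in>Y. ((\<lambda>s. m s y) has_real_derivative
        drift_b Y U\<^sub>\<rho> F\<^sub>\<mu> \<sigma> (dens_meas X (n t)) (m t) y * m t y) (at t within {0..}))"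

end

theory Submission
  imports Defs
begin

text \<open>
  Along the flow, the log-ratio \<open>l\<^sub>t = log (\<nu>\<^sub>t/\<pi>)\<close> satisfies \<open>\<partial>\<^sub>t l\<^sub>t = - f\<^sub>t - (\<sigma>\<^sup>2/2) l\<^sub>t + (\<sigma>\<^sup>2/2) D\<^sub>K\<^sub>L(\<nu>\<^sub>t|\<pi>)\<close>
  with \<open>f\<^sub>t\<close> bounded. The divergence does not depend on the point, so differences of \<open>l\<^sub>t\<close> between two
  points stay bounded, and since \<open>\<nu>\<^sub>t\<close> and \<open>\<pi>\<close> have the same mass, \<open>l\<^sub>t\<close> itself is bounded uniformly in
  time. Hence \<open>D\<^sub>K\<^sub>L(\<nu>|\<nu>\<^sub>t) = D\<^sub>K\<^sub>L(\<nu>|\<pi>) - \<integral>l\<^sub>t d\<nu>\<close> can be differentiated under the integral sign.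

  By convexity-concavity, the derivative of the divergence \<open>D\<close> from the equilibrium is at most
  \<open>V(\<nu>\<^sup>*, \<mu>\<^sub>t) - V(\<nu>\<^sub>t, \<mu>\<^sup>*) - (\<sigma>\<^sup>2/2) D\<close>, and the difference of values is nonpositive at an equilibrium; the
  first-order condition for the equilibrium is not needed. For the Nikaido-Isoda error, convexity gives
  \<open>V(\<nu>\<^sub>t, \<mu>) - V(\<nu>\<^sup>*, \<mu>) \<le> \<integral>a(\<nu>\<^sub>t, \<mu>) d(\<nu>\<^sub>t - \<nu>\<^sup>*)\<close>, which Pinsker's inequality bounds by
  \<open>C\<^sub>1 sqrt (2 D\<^sub>K\<^sub>L(\<nu>\<^sup>*|\<nu>\<^sub>t))\<close>.
\<close>

section \<open>Relative entropy\<close>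

text \<open>\<open>KL\<close> is defined through \<open>RN_deriv\<close>, which is unique only up to
  null sets. A concrete real density may replace it because integrability and the integral do not
  see null sets of \<open>density M D\<close>.\<close>

lemma KL_density_eq:
  fixes D :: "'a \<Rightarrow> real"
  assumes "prob_space M" and D: "D \<in> borel_measurable M" "AE x in M. 0 \<le> D x"
  shows "KL (density M D) M =
    (if integrable (density M D) (\<lambda>x. ln (D x)) then ereal (\<integral>x. ln (D x) \<partial>density M D) else \<infinity>)"
proof -
  interpret prob_space M by fact
  let ?N = "density M D"
  have ac: "absolutely_continuous M ?N"
    using D by (intro absolutely_continuousI_density) auto
  have "AE x in M. ennreal (D x) = RN_deriv M ?N x"
    using D by (intro RN_deriv_unique) auto
  then have "AE x in M. entropy_density (exp 1) M ?N x = ln (D x)"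
    using D(2) by eventually_elim (auto simp: entropy_density_def log_def enn2real_ennreal dest: sym)
  then have ae: "AE x in ?N. entropy_density (exp 1) M ?N x = ln (D x)"
    by (rule absolutely_continuous_AE[OF _ ac, rotated]) simp
  have m: "entropy_density (exp 1) M ?N \<in> borel_measurable ?N" "(\<lambda>x. ln (D x)) \<in> borel_measurable ?N"
    using measurable_entropy_density[of "exp 1" M ?N] D by (auto cong: measurable_cong_sets)
  show ?thesis
    unfolding KL_def KL_divergence_def
    using integrable_cong_AE[OF m ae] integral_cong_AE[OF m ae] ac by simp
qed

text \<open>A real representative of the Radon-Nikodym derivative. Positivity holds
  \<open>N\<close>-almost everywhere, which suffices to split logarithms under integrals over
  \<open>N\<close>.\<close>

lemma absolutely_continuous_real_density:
  assumes "prob_space M" "prob_space N" "sets N = sets M" "absolutely_continuous M N"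
  obtains D :: "'a \<Rightarrow> real" where "D \<in> borel_measurable M" "\<forall>x. 0 \<le> D x" "N = density M D" "AE x in N. 0 < D x"
proof -
  interpret M: prob_space M by fact
  interpret N: prob_space N by fact
  have "finite_measure N" by unfold_locales
  from M.real_RN_deriv[OF this assms(4,3)] obtain D
    where D: "D \<in> borel_measurable M" "AE x in M. RN_deriv M N x = ennreal (D x)"
      "AE x in N. 0 < D x" "\<And>x. 0 \<le> D x"
    by this auto
  have "N = density M (RN_deriv M N)"
    using assms by (intro M.density_RN_deriv[symmetric])
  also have "\<dots> = density M D"
    using D by (auto intro!: density_cong)
  finally show ?thesis using D by (intro that[of D]) auto
qed

lemma KL_not_ac: "\<not> absolutely_continuous M N \<Longrightarrow> KL N M = \<infinity>"
  by (simp add: KL_def)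

text \<open>The density of \<open>N\<close> relative to the tilted measure is
  \<open>D x * exp (- l x)\<close>, whose logarithm is \<open>ln (D x) - l x\<close>. As
  \<open>l\<close> is bounded, subtracting it does not affect integrability, so the identity
  persists when both divergences are infinite.\<close>

lemma KL_change_reference:
  fixes l :: "'a \<Rightarrow> real"
  assumes M: "prob_space M" and N: "prob_space N" and s: "sets N = sets M"
    and l: "l \<in> borel_measurable M" "\<And>x. x \<in> space M \<Longrightarrow> \<bar>l x\<bar> \<le> B"
    and M': "prob_space (density M (\<lambda>x. ennreal (exp (l x))))"
  shows "KL N M = KL N (density M (\<lambda>x. ennreal (exp (l x)))) + ereal (\<integral>x. l x \<partial>N)"
proof -
  interpret N: prob_space N by fact
  interpret M: prob_space M by fact
  let ?M' = "density M (\<lambda>x. ennreal (exp (l x)))"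
  have sp: "space N = space M"
    using s by (rule sets_eq_imp_space_eq)
  have lN: "l \<in> borel_measurable N"
    using l(1) s by (simp cong: measurable_cong_sets)
  have li: "integrable N l"
    using l lN sp by (intro N.integrable_const_bound[where B=B]) auto
  show ?thesis
  proof (cases "absolutely_continuous M N")
    case True
    obtain D :: "'a \<Rightarrow> real" where D: "D \<in> borel_measurable M" "\<forall>x. 0 \<le> D x" "N = density M D" "AE x in N. 0 < D x"
      by (rule absolutely_continuous_real_density[OF M N s True])
    let ?D' = "\<lambda>x. D x * exp (- l x)"
    have N': "N = density ?M' ?D'"
    proof -
      have "density ?M' ?D' = density M (\<lambda>x. ennreal (exp (l x)) * ennreal (?D' x))"
        using D(1) l(1) by (intro density_density_eq) auto
      also have "(\<lambda>x. ennreal (exp (l x)) * ennreal (?D' x)) = (\<lambda>x. ennreal (D x))"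
        using D(2) by (auto simp: ennreal_mult[symmetric] exp_minus field_simps)
      finally show ?thesis using D(3) by simp
    qed
    have DN: "D \<in> borel_measurable N"
      using D(1) s by (simp cong: measurable_cong_sets)
    have ae: "AE x in N. ln (?D' x) = ln (D x) - l x"
      using D(4) by eventually_elim (simp add: ln_mult)
    have "KL N M = (if integrable N (\<lambda>x. ln (D x)) then ereal (\<integral>x. ln (D x) \<partial>N) else \<infinity>)"
      using KL_density_eq[OF M D(1)] D(2) D(3)[symmetric] by simp
    moreover have "KL N ?M' = (if integrable N (\<lambda>x. ln (?D' x)) then ereal (\<integral>x. ln (?D' x) \<partial>N) else \<infinity>)"
    proof -
      have "KL (density ?M' ?D') ?M' = (if integrable (density ?M' ?D') (\<lambda>x. ln (?D' x))
          then ereal (\<integral>x. ln (?D' x) \<partial>density ?M' ?D') else \<infinity>)"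
        using D(1,2) l(1) by (intro KL_density_eq M') auto
      then show ?thesis by (simp only: N'[symmetric])
    qed
    moreover have "integrable N (\<lambda>x. ln (?D' x)) \<longleftrightarrow> integrable N (\<lambda>x. ln (D x) - l x)"
      using ae DN lN by (intro integrable_cong_AE) auto
    moreover have "(\<integral>x. ln (?D' x) \<partial>N) = (\<integral>x. ln (D x) - l x \<partial>N)"
      using ae DN lN by (intro integral_cong_AE) auto
    moreover have "integrable N (\<lambda>x. ln (D x) - l x) \<longleftrightarrow> integrable N (\<lambda>x. ln (D x))"
    proof
      assume "integrable N (\<lambda>x. ln (D x) - l x)"
      from Bochner_Integration.integrable_add[OF this li] show "integrable N (\<lambda>x. ln (D x))" by simp
    qed (use li in simp)
    ultimately show ?thesis
      using li by (cases "integrable N (\<lambda>x. ln (D x))") simp_all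
  next
    case False
    \<comment> \<open>The tilt is positive everywhere, so it neither creates nor removes null sets:
      both divergences are infinite here.\<close>
    have "null_sets ?M' = null_sets M"
    proof (intro set_eqI)
      fix A
      show "A \<in> null_sets ?M' \<longleftrightarrow> A \<in> null_sets M"
        using l(1) by (subst null_sets_density_iff) (auto simp: AE_iff_null_sets intro: AE_not_in)
    qed
    with False have "\<not> absolutely_continuous ?M' N"
      by (simp add: absolutely_continuous_def)
    with False show ?thesis by (simp add: KL_not_ac)
  qed
qed

text \<open>The Donsker-Varadhan inequality, with the exponential moment controlled by Hoeffding's lemma.\<close>

lemma KL_dual_bound:
  fixes g :: "'a \<Rightarrow> real"
  assumes M: "prob_space M" and N: "prob_space N" and s: "sets N = sets M"
    and fin: "KL N M < \<infinity>" and g: "g \<in> borel_measurable M" "\<And>x. x \<in> space M \<Longrightarrow> \<bar>g x\<bar> \<le> C"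
    and z: "z > 0"
  shows "z * ((\<integral>x. g x \<partial>N) - (\<integral>x. g x \<partial>M)) \<le> real_of_ereal (KL N M) + z\<^sup>2 * C\<^sup>2 / 2"
proof -
  interpret N: prob_space N by fact
  interpret M: prob_space M by fact
  interpret H: interval_bounded_random_variable M g "- C" C
    by unfold_locales (use g in \<open>auto intro!: AE_I2 simp: abs_le_iff minus_le_iff\<close>)
  have sp: "space N = space M"
    using s by (rule sets_eq_imp_space_eq)
  have gN: "g \<in> borel_measurable N"
    using g(1) s by (simp cong: measurable_cong_sets)
  have gi: "integrable N g"
    using g gN sp by (intro N.integrable_const_bound[where B=C]) auto
  have ac: "absolutely_continuous M N"
    using fin by (auto simp: KL_def split: if_splits)
  obtain D :: "'a \<Rightarrow> real" where D: "D \<in> borel_measurable M" "\<forall>x. 0 \<le> D x" "N = density M D" "AE x in N. 0 < D x"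
    by (rule absolutely_continuous_real_density[OF M N s ac])
  have KL: "KL N M = (if integrable N (\<lambda>x. ln (D x)) then ereal (\<integral>x. ln (D x) \<partial>N) else \<infinity>)"
    using KL_density_eq[OF M D(1)] D(2) D(3)[symmetric] by simp
  with fin have Di: "integrable N (\<lambda>x. ln (D x))"
    by (auto split: if_splits)
  let ?E = "integral\<^sup>L M g"
  \<comment> \<open>Hoeffding's lemma on [-C, C] gives the exponent z^2 (2C)^2 / 8 = z^2 C^2 / 2.
    Subtracting it makes the \<open>M\<close>-integral of \<open>exp (u x)\<close> at most
    one.\<close>
  define u where "u x = z * (g x - ?E) - z\<^sup>2 * C\<^sup>2 / 2" for x
  have u_meas: "u \<in> borel_measurable M" using g by (simp add: u_def[abs_def])
  have ui: "integrable N u"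
    using gi by (auto simp: u_def[abs_def])
  have "(\<integral>\<^sup>+x. ennreal (exp (u x)) \<partial>M) = (\<integral>\<^sup>+x. ennreal (exp (- (z\<^sup>2 * C\<^sup>2 / 2))) * ennreal (exp (z * (g x - ?E))) \<partial>M)"
    by (intro nn_integral_cong) (simp add: u_def ennreal_mult[symmetric] mult_exp_exp)
  also have "\<dots> = ennreal (exp (- (z\<^sup>2 * C\<^sup>2 / 2))) * (\<integral>\<^sup>+x. ennreal (exp (z * (g x - ?E))) \<partial>M)"
    using g by (intro nn_integral_cmult) auto
  also have "\<dots> \<le> ennreal (exp (- (z\<^sup>2 * C\<^sup>2 / 2))) * ennreal (exp (z\<^sup>2 * (C - (- C))\<^sup>2 / 8))"
    using H.Hoeffdings_lemma_nn_integral[OF z] by (intro mult_left_mono) auto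
  also have "\<dots> = 1"
    by (simp add: ennreal_mult[symmetric] exp_minus power2_eq_square field_simps)
  finally have e1: "(\<integral>\<^sup>+x. ennreal (exp (u x)) \<partial>M) \<le> 1" .
  then have ei: "integrable M (\<lambda>x. exp (u x))"
    using u_meas by (intro integrableI_nonneg) (auto intro: le_less_trans)
  have e1': "(\<integral>x. exp (u x) \<partial>M) \<le> 1"
    using e1 nn_integral_eq_integral[OF ei] by simp
  have Dm: "integrable M D" "integral\<^sup>L M D = 1"
  proof -
    have "(\<integral>\<^sup>+x. ennreal (D x) \<partial>M) = emeasure (density M D) (space M)"
      using D(1) by (simp add: emeasure_density cong: nn_integral_cong)
    also have "\<dots> = 1" using N.emeasure_space_1 D(3) sp by simp
    finally have *: "(\<integral>\<^sup>+x. ennreal (D x) \<partial>M) = 1" .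
    then show i: "integrable M D"
      using D by (intro integrableI_nonneg) auto
    from * show "integral\<^sup>L M D = 1"
      using nn_integral_eq_integral[OF i] D(2) by simp
  qed
  have "(\<integral>x. u x - ln (D x) \<partial>N) = (\<integral>x. D x * (u x - ln (D x)) \<partial>M)"
    unfolding D(3) using D u_meas by (subst integral_real_density) auto
  \<comment> \<open>Pointwise this is 1 + s \<le> exp s at \<open>s = u x - ln (D x)\<close>,
    multiplied by \<open>D x\<close>. The right side integrates to at most 1 - 1 = 0. Where
    \<open>D x = 0\<close>, the factor kills the default value of the logarithm.\<close>
  also have "\<dots> \<le> (\<integral>x. exp (u x) - D x \<partial>M)"
  proof (rule integral_mono)
    have "integrable N (\<lambda>x. u x - ln (D x))" using ui Di by auto
    then show "integrable M (\<lambda>x. D x * (u x - ln (D x)))"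
      unfolding D(3) using D u_meas by (subst (asm) integrable_real_density) auto
    show "integrable M (\<lambda>x. exp (u x) - D x)" using ei Dm by auto
    fix x assume "x \<in> space M"
    show "D x * (u x - ln (D x)) \<le> exp (u x) - D x"
    proof (cases "D x = 0")
      case False
      with D(2) have p: "0 < D x" by (auto simp: less_le)
      have "1 + (u x - ln (D x)) \<le> exp (u x - ln (D x))" by (rule exp_ge_add_one_self)
      also have "\<dots> = exp (u x) / D x" using p by (simp add: exp_diff)
      finally show ?thesis using p by (simp add: field_simps)
    qed simp
  qed
  also have "\<dots> \<le> 0" using ei Dm e1' by simp
  finally have "(\<integral>x. u x \<partial>N) \<le> (\<integral>x. ln (D x) \<partial>N)" using ui Di by simp
  moreover have "(\<integral>x. u x \<partial>N) = z * ((\<integral>x. g x \<partial>N) - ?E) - z\<^sup>2 * C\<^sup>2 / 2"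
    using gi by (simp add: u_def[abs_def] N.prob_space)
  moreover have "real_of_ereal (KL N M) = (\<integral>x. ln (D x) \<partial>N)" using KL Di by simp
  ultimately show ?thesis by linarith
qed

lemma KL_nonneg:
  assumes "prob_space M" "prob_space N" "sets N = sets M"
  shows "0 \<le> KL N M"
proof (cases "KL N M")
  case (real r)
  then show ?thesis
    using KL_dual_bound[OF assms, of "\<lambda>_. 0" 0 1] by simp
qed (auto simp: KL_def split: if_splits)

text \<open>The dual bound is quadratic in \<open>z\<close>; optimising over \<open>z\<close> gives
  Pinsker's inequality, with a bounded test function in place of the total variation.\<close>

lemma Pinsker_dual:
  fixes g :: "'a \<Rightarrow> real"
  assumes M: "prob_space M" and N: "prob_space N" and s: "sets N = sets M"
    and fin: "KL N M < \<infinity>" and g: "g \<in> borel_measurable M" "\<And>x. x \<in> space M \<Longrightarrow> \<bar>g x\<bar> \<le> C"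
    and C: "0 < C"
  shows "(\<integral>x. g x \<partial>N) - (\<integral>x. g x \<partial>M) \<le> C * sqrt (2 * real_of_ereal (KL N M))"
proof -
  define d where "d = (\<integral>x. g x \<partial>N) - (\<integral>x. g x \<partial>M)"
  define k where "k = real_of_ereal (KL N M)"
  have b: "z * d \<le> k + z\<^sup>2 * C\<^sup>2 / 2" if "z > 0" for z
    using KL_dual_bound[OF M N s fin g that] by (simp add: d_def k_def)
  show ?thesis
  proof (cases "d \<le> 0")
    case True
    have "0 \<le> k" unfolding k_def using KL_nonneg[OF M N s] by (simp add: real_of_ereal_pos)
    with C have "0 \<le> C * sqrt (2 * k)" by simp
    with True show ?thesis by (simp add: d_def k_def)
  next
    case False
    \<comment> \<open>The maximiser of z d - z^2 C^2 / 2 is z = d / C^2, with maximum d^2 / (2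
      C^2).\<close>
    with b[of "d / C\<^sup>2"] C have "d\<^sup>2 / C\<^sup>2 \<le> 2 * k"
      by (simp add: power2_eq_square field_simps)
    then have "(d / C)\<^sup>2 \<le> 2 * k" by (simp add: power_divide)
    then have "d / C \<le> sqrt (2 * k)" by (rule real_le_rsqrt)
    with C show ?thesis by (simp add: d_def k_def field_simps)
  qed
qed

section \<open>Scalar differential inequalities\<close>

text \<open>The derivative of \<open>exp (c * t) * v t\<close> is nonpositive, so the mean value
  theorem applies. Derivatives within \<open>{0..T}\<close> allow one-sided differentiability at the
  endpoints.\<close>

lemma exponential_decay:
  fixes v :: "real \<Rightarrow> real"
  assumes T: "0 \<le> T"
    and v: "\<And>t. 0 \<le> t \<Longrightarrow> t \<le> T \<Longrightarrow> (v has_real_derivative v' t) (at t within {0..T})"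
    and le: "\<And>t. 0 \<le> t \<Longrightarrow> t \<le> T \<Longrightarrow> v' t \<le> - c * v t"
  shows "v T \<le> exp (- c * T) * v 0"
proof -
  have "\<exists>s\<in>{0..T}. exp (c * T) * v T - exp (c * 0) * v 0 = (c * v s + v' s) * exp (c * s) * (T - 0)"
  proof (rule mvt_very_simple[OF T])
    fix s assume s: "0 \<le> s" "s \<le> T"
    show "((\<lambda>t. exp (c * t) * v t) has_derivative (*) ((c * v s + v' s) * exp (c * s))) (at s within {0..T})"
      unfolding has_field_derivative_def[symmetric]
      by (auto intro!: derivative_eq_intros v[OF s] simp: algebra_simps)
  qed
  then obtain s where s: "0 \<le> s" "s \<le> T"
    and eq: "exp (c * T) * v T - v 0 = (c * v s + v' s) * exp (c * s) * T"
    by auto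
  have "(c * v s + v' s) * exp (c * s) * T \<le> 0"
    using le[OF s] T by (intro mult_nonpos_nonneg) auto
  with eq have "exp (c * T) * v T \<le> v 0" by simp
  then have "exp (- c * T) * (exp (c * T) * v T) \<le> exp (- c * T) * v 0"
    by (intro mult_left_mono) auto
  then show ?thesis
    by (simp add: mult.assoc[symmetric] mult_exp_exp)
qed

text \<open>Subtracting the stationary value \<open>k / c\<close> reduces the claim to pure decay.
  The bound is free of \<open>T\<close>, which is what yields control uniform in time.\<close>

lemma affine_growth_bound:
  fixes u :: "real \<Rightarrow> real"
  assumes T: "0 \<le> T" and c: "c > 0" and k: "k \<ge> 0"
    and u: "\<And>t. 0 \<le> t \<Longrightarrow> t \<le> T \<Longrightarrow> (u has_real_derivative u' t) (at t within {0..T})"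
    and le: "\<And>t. 0 \<le> t \<Longrightarrow> t \<le> T \<Longrightarrow> u' t \<le> k - c * u t"
  shows "u T \<le> \<bar>u 0\<bar> + k / c"
proof -
  have "u T - k / c \<le> exp (- c * T) * (u 0 - k / c)"
  proof (rule exponential_decay[OF T])
    fix t assume t: "0 \<le> t" "t \<le> T"
    show "((\<lambda>t. u t - k / c) has_real_derivative u' t) (at t within {0..T})"
      by (auto intro!: derivative_eq_intros u[OF t])
    show "u' t \<le> - c * (u t - k / c)"
      using le[OF t] c by (simp add: algebra_simps)
  qed
  also have "\<dots> \<le> exp (- c * T) * \<bar>u 0\<bar>"
    using c k by (intro mult_left_mono) (auto simp: abs_real_def intro: order_trans[of _ 0])
  also have "\<dots> \<le> 1 * \<bar>u 0\<bar>"
    using c T by (intro mult_right_mono) auto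
  finally show ?thesis by simp
qed

lemma has_real_derivative_ln_ratio:
  fixes y :: "real \<Rightarrow> real"
  assumes "(y has_real_derivative - g * y t) (at t within S)" "0 < y t" "0 < p"
  shows "((\<lambda>s. ln (y s / p)) has_real_derivative - g) (at t within S)"
  using assms by (auto intro!: derivative_eq_intros simp: field_simps)

text \<open>Before the first failure of positivity, \<open>- ln (y t / p)\<close> obeys an affine
  differential inequality. Hence \<open>y\<close> stays above a fixed positive level up to that
  time, and continuity rules the failure out.\<close>

lemma entropic_ode_positive:
  fixes y :: "real \<Rightarrow> real"
  assumes p: "0 < p" and y0: "0 < y 0" and c: "0 < c" and C: "0 \<le> C"
    and y: "\<And>t. 0 \<le> t \<Longrightarrow>
      (y has_real_derivative - (f t + c * ln (y t / p) - c * K t) * y t) (at t within {0..})"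
    and f: "\<And>t. 0 \<le> t \<Longrightarrow> \<bar>f t\<bar> \<le> C" and K: "\<And>t. 0 \<le> t \<Longrightarrow> 0 \<le> K t"
    and T: "0 \<le> T"
  shows "0 < y T"
proof (rule ccontr)
  assume "\<not> 0 < y T"
  \<comment> \<open>\<open>S\<close> collects the times at which positivity has failed. It is
    closed, so its infimum is the first such time.\<close>
  define S where "S = {s\<in>{0..T}. y s \<le> 0}"
  have cont: "continuous_on {0..} y"
    using y by (intro DERIV_continuous_on) auto
  have "closed S"
  proof -
    have "closed ({0..T} \<inter> y -` {..0})"
      by (intro continuous_closed_preimage continuous_on_subset[OF cont]) auto
    also have "{0..T} \<inter> y -` {..0} = S" by (auto simp: S_def)
    finally show ?thesis .
  qed
  moreover have "T \<in> S" using T \<open>\<not> 0 < y T\<close> by (auto simp: S_def)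
  moreover have bdd: "bdd_below S" by (auto simp: S_def intro!: bdd_belowI[of _ 0])
  ultimately have "Inf S \<in> S" by (intro closed_contains_Inf) auto
  define \<tau> where "\<tau> = Inf S"
  have \<tau>: "0 \<le> \<tau>" "y \<tau> \<le> 0" using \<open>Inf S \<in> S\<close> by (auto simp: \<tau>_def S_def)
  then have "0 < \<tau>" using y0 by (cases "\<tau> = 0") auto
  have pos: "0 < y s" if "0 \<le> s" "s < \<tau>" for s
  proof (rule ccontr)
    assume "\<not> 0 < y s"
    with that \<open>Inf S \<in> S\<close> have "s \<in> S" by (auto simp: S_def \<tau>_def)
    then have "\<tau> \<le> s" unfolding \<tau>_def by (intro cInf_lower bdd)
    with that show False by simp
  qed
  define L where "L = \<bar>ln (y 0 / p)\<bar> + C / c"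
  have low: "p * exp (- L) \<le> y s" if s: "s \<in> {0..<\<tau>}" for s
  proof -
    have "- ln (y s / p) \<le> \<bar>- ln (y 0 / p)\<bar> + C / c"
    proof (rule affine_growth_bound[OF _ c C])
      fix t assume t: "0 \<le> t" "t \<le> s"
      have "((\<lambda>s. ln (y s / p)) has_real_derivative - (f t + c * ln (y t / p) - c * K t)) (at t within {0..s})"
        using t s p pos y by (intro has_real_derivative_ln_ratio DERIV_subset[OF y]) auto
      from DERIV_minus[OF this]
      show "((\<lambda>s. - ln (y s / p)) has_real_derivative (f t + c * ln (y t / p) - c * K t)) (at t within {0..s})"
        by simp
      \<comment> \<open>The term with \<open>K\<close> pushes \<open>y\<close> upwards, so its sign
        suffices and no upper bound on the divergence has to be known yet.\<close>
      have "0 \<le> c * K t" using c K[OF t(1)] by simp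
      with f[OF t(1)] show "f t + c * ln (y t / p) - c * K t \<le> C - c * (- ln (y t / p))"
        by simp
    qed (use s in auto)
    then have "- L \<le> ln (y s / p)" by (simp add: L_def)
    moreover have "0 < y s / p" using s pos p by simp
    ultimately have "exp (- L) \<le> y s / p" by (simp add: ln_ge_iff)
    with p show ?thesis by (simp add: field_simps)
  qed
  have "p * exp (- L) \<le> y \<tau>"
  proof (rule continuous_ge_on_closure[where S="{0..<\<tau>}" and f=y and x=\<tau>])
    show "continuous_on (closure {0..<\<tau>}) y"
      using \<open>0 < \<tau>\<close> by (auto intro: continuous_on_subset[OF cont])
    show "\<tau> \<in> closure {0..<\<tau>}" using \<open>0 < \<tau>\<close> by auto
  qed (rule low)
  moreover have "0 < p * exp (- L)" using p by simp
  ultimately show False using \<tau> by simp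
qed

text \<open>Difference quotients converge pointwise to \<open>l'\<close> and, by the mean value
  theorem, are bounded by \<open>C\<close>. Pointwise limits give measurability of
  \<open>l' t\<close>; dominated convergence gives the derivative of the integral, one-sided at time
  0.\<close>

lemma
  fixes l l' :: "real \<Rightarrow> 'a \<Rightarrow> real"
  assumes M: "finite_measure M"
    and meas: "\<And>t. 0 \<le> t \<Longrightarrow> l t \<in> borel_measurable M"
    and bound: "\<And>t x. 0 \<le> t \<Longrightarrow> x \<in> space M \<Longrightarrow> \<bar>l t x\<bar> \<le> B"
    and deriv: "\<And>t x. 0 \<le> t \<Longrightarrow> x \<in> space M \<Longrightarrow>
      ((\<lambda>s. l s x) has_real_derivative l' t x) (at t within {0..})"
    and deriv_bound: "\<And>t x. 0 \<le> t \<Longrightarrow> x \<in> space M \<Longrightarrow> \<bar>l' t x\<bar> \<le> C"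
    and t: "0 \<le> t"
  shows borel_measurable_time_derivative: "l' t \<in> borel_measurable M"
    and has_real_derivative_integral_bounded:
      "((\<lambda>s. \<integral>x. l s x \<partial>M) has_real_derivative (\<integral>x. l' t x \<partial>M)) (at t within {0..})"
proof -
  interpret finite_measure M by fact
  define q where "q s x = (l s x - l t x) / (s - t)" for s x
  have q_meas: "q s \<in> borel_measurable M" if "0 \<le> s" for s
    using meas[OF that] meas[OF t] by (simp add: q_def[abs_def])
  have lim: "(\<lambda>i. q (X i) x) \<longlonglongrightarrow> l' t x"
    if X: "\<forall>i. X i \<in> {0..} - {t}" "X \<longlonglongrightarrow> t" and x: "x \<in> space M" for X x
  proof -
    have "((\<lambda>s. q s x) \<longlongrightarrow> l' t x) (at t within {0..})"
      using deriv[OF t x] unfolding has_field_derivative_iff q_def .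
    from this[unfolded tendsto_at_iff_sequentially] X show ?thesis
      by (auto simp: o_def)
  qed
  \<comment> \<open>Approaching from the right stays in the time domain even when
    \<open>t = 0\<close>, and never meets \<open>t\<close>.\<close>
  define Z where "Z i = t + 1 / real (Suc i)" for i
  have Z: "\<forall>i. Z i \<in> {0..} - {t}" "Z \<longlonglongrightarrow> t"
    using t tendsto_add[OF tendsto_const[of t] LIMSEQ_inverse_real_of_nat]
    by (auto simp: Z_def[abs_def] inverse_eq_divide intro: add_nonneg_nonneg)
  show m': "l' t \<in> borel_measurable M"
    by (rule borel_measurable_LIMSEQ_real[where u="\<lambda>i. q (Z i)"]) (use lim Z q_meas in auto)
  have int: "integrable M (l s)" if "0 \<le> s" for s
    using bound[OF that] meas[OF that] by (intro integrable_const_bound[where B=B]) auto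
  show "((\<lambda>s. \<integral>x. l s x \<partial>M) has_real_derivative (\<integral>x. l' t x \<partial>M)) (at t within {0..})"
    unfolding has_field_derivative_iff tendsto_at_iff_sequentially
  proof (intro allI impI)
    fix X :: "nat \<Rightarrow> real" assume X: "\<forall>i. X i \<in> {0..} - {t}" "X \<longlonglongrightarrow> t"
    have "(\<lambda>i. \<integral>x. q (X i) x \<partial>M) \<longlonglongrightarrow> (\<integral>x. l' t x \<partial>M)"
    proof (rule integral_dominated_convergence[where w="\<lambda>_. C"])
      show "q (X i) \<in> borel_measurable M" for i using X q_meas by auto
      show "AE x in M. (\<lambda>i. q (X i) x) \<longlonglongrightarrow> l' t x" using lim[OF X] by auto
      show "AE x in M. norm (q (X i) x) \<le> C" for i
      proof (rule AE_I2)
        fix x assume x: "x \<in> space M"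
        have "norm (l (X i) x - l t x) \<le> C * norm (X i - t)"
          using X t deriv[OF _ x] deriv_bound[OF _ x]
          by (intro field_differentiable_bound[where S="{0..}" and f'="\<lambda>s. l' s x"]) auto
        moreover have "X i \<noteq> t" using X by auto
        ultimately show "norm (q (X i) x) \<le> C" by (simp add: q_def field_simps)
      qed
    qed (use m' in auto)
    moreover have "(\<integral>x. q (X i) x \<partial>M) = ((\<integral>x. l (X i) x \<partial>M) - (\<integral>x. l t x \<partial>M)) / (X i - t)" for i
      using int[OF t] int[of "X i"] X by (simp add: q_def)
    ultimately show "((\<lambda>s. ((\<integral>x. l s x \<partial>M) - (\<integral>x. l t x \<partial>M)) / (s - t)) \<circ> X) \<longlonglongrightarrow> (\<integral>x. l' t x \<partial>M)"
      by (simp add: o_def)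
  qed
qed

section \<open>The flow of a single player\<close>

lemma KL_same: "prob_space M \<Longrightarrow> KL M M = 0"
  using KL_density_eq[of M "\<lambda>_. 1"] by (simp add: density_1 zero_ereal_def)

section \<open>Probability measures and densities on a subset of the space\<close>

lemma prob_onD:
  assumes "\<nu> \<in> prob_on X"
  shows "prob_space \<nu>" "sets \<nu> = sets (restrict_space borel X)" "space \<nu> = X"
proof -
  show "prob_space \<nu>" and s: "sets \<nu> = sets (restrict_space borel X)"
    using assms by (auto simp: prob_on_def)
  from sets_eq_imp_space_eq[OF s] show "space \<nu> = X" by (simp add: space_restrict_space)
qed

lemma sets_restrict_lborel: "sets (restrict_space lborel X) = sets (restrict_space borel X)"
  by (intro sets_restrict_space_cong) simp

lemma dens_meas_prob_on: "prob_density_on X q \<Longrightarrow> dens_meas X q \<in> prob_on X"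
  by (simp add: prob_on_def prob_density_on_def dens_meas_def sets_restrict_lborel)

lemma prob_on_measurable_cong:
  assumes "\<nu> \<in> prob_on X"
  shows "borel_measurable \<nu> = borel_measurable (restrict_space borel X)"
  by (rule measurable_cong_sets) (simp_all add: prob_onD[OF assms])

lemma prob_density_measurable:
  assumes "prob_density_on X q"
  shows "q \<in> borel_measurable (restrict_space lborel X)"
  using assms measurable_cong_sets[OF sets_restrict_lborel refl, of X "borel :: real measure"]
  by (simp add: prob_density_on_def)

lemma nn_integral_prob_density:
  assumes q: "prob_density_on X q"
  shows "(\<integral>\<^sup>+x. ennreal (q x) \<partial>restrict_space lborel X) = 1"
proof -
  interpret prob_space "dens_meas X q" using q by (simp add: prob_density_on_def)
  have "(\<integral>\<^sup>+x. ennreal (q x) \<partial>restrict_space lborel X) = emeasure (dens_meas X q) (space (restrict_space lborel X))"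
    using prob_density_measurable[OF q]
    by (simp add: dens_meas_def emeasure_density cong: nn_integral_cong)
  also have "\<dots> = 1" using emeasure_space_1 by (simp add: dens_meas_def)
  finally show ?thesis .
qed

text \<open>Integrating over \<open>y\<close> removes the unknown normalisation of the ratio \<open>q\<^sub>1 / q\<^sub>2\<close>.\<close>

lemma prob_density_ratio_le:
  assumes q1: "prob_density_on X q1" and q2: "prob_density_on X q2" and A: "0 \<le> A"
    and le: "\<And>x y. x \<in> X \<Longrightarrow> y \<in> X \<Longrightarrow> q1 x * q2 y \<le> A * (q1 y * q2 x)"
    and x: "x \<in> X"
  shows "q1 x \<le> A * q2 x"
proof -
  let ?L = "restrict_space lborel X"
  have nn: "0 \<le> q1 y" "0 \<le> q2 y" if "y \<in> X" for y
    using q1 q2 that by (auto simp: prob_density_on_def)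
  have sp: "space ?L = X" by (simp add: space_restrict_space)
  have "ennreal (q1 x) = ennreal (q1 x) * (\<integral>\<^sup>+y. ennreal (q2 y) \<partial>?L)"
    by (simp add: nn_integral_prob_density[OF q2])
  also have "\<dots> = (\<integral>\<^sup>+y. ennreal (q1 x) * ennreal (q2 y) \<partial>?L)"
    using prob_density_measurable[OF q2] by (intro nn_integral_cmult[symmetric]) auto
  also have "\<dots> \<le> (\<integral>\<^sup>+y. ennreal (A * q2 x) * ennreal (q1 y) \<partial>?L)"
  proof (rule nn_integral_mono)
    fix y assume "y \<in> space ?L"
    then have y: "y \<in> X" by (simp add: sp)
    show "ennreal (q1 x) * ennreal (q2 y) \<le> ennreal (A * q2 x) * ennreal (q1 y)"
      using le[OF x y] nn[OF x] nn[OF y] A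
      by (simp add: ennreal_mult[symmetric] mult_ac ennreal_leI)
  qed
  also have "\<dots> = ennreal (A * q2 x) * (\<integral>\<^sup>+y. ennreal (q1 y) \<partial>?L)"
    using prob_density_measurable[OF q1] by (intro nn_integral_cmult) auto
  also have "\<dots> = ennreal (A * q2 x)"
    by (simp add: nn_integral_prob_density[OF q1])
  finally show ?thesis using A nn[OF x] by simp
qed

text \<open>One player in isolation: the opponent enters only through the forcing \<open>f\<close>,
  bounded by \<open>C\<close>. The minimiser and the maximiser are both instances, with
  \<open>c\<close> the entropic weight.\<close>

locale entropic_flow =
  fixes X :: "'a::euclidean_space set" and p :: "'a \<Rightarrow> real" and n f :: "real \<Rightarrow> 'a \<Rightarrow> real"
    and c C r R :: real
  assumes p: "prob_density_on X p" and p_pos: "\<And>x. x \<in> X \<Longrightarrow> 0 < p x"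
    and c: "0 < c" and C: "0 \<le> C"
    and n: "\<And>t. 0 \<le> t \<Longrightarrow> prob_density_on X (n t)"
    and ode: "\<And>t x. 0 \<le> t \<Longrightarrow> x \<in> X \<Longrightarrow> ((\<lambda>s. n s x) has_real_derivative
      - (f t x + c * ln (n t x / p x) - c * real_of_ereal (KL (dens_meas X (n t)) (dens_meas X p))) * n t x)
      (at t within {0..})"
    and f_bound: "\<And>t x. 0 \<le> t \<Longrightarrow> x \<in> X \<Longrightarrow> \<bar>f t x\<bar> \<le> C"
    and r: "0 < r" and ratio: "\<And>x. x \<in> X \<Longrightarrow> r \<le> n 0 x / p x" "\<And>x. x \<in> X \<Longrightarrow> n 0 x / p x \<le> R"
begin

section \<open>Positivity of the flow and a time-uniform bound on the log-ratio\<close>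

abbreviation "P \<equiv> dens_meas X p"
abbreviation "N t \<equiv> dens_meas X (n t)"

definition "l t x = ln (n t x / p x)"
definition "K t = real_of_ereal (KL (N t) P)"
definition "drift t x = f t x + c * l t x - c * K t"
text \<open>Two initial log-ratios, each at most the maximum in modulus, plus the stationary value
  \<open>2 * C / c\<close> of the affine inequality for a difference of log-ratios.\<close>

definition "B = 2 * max \<bar>ln r\<bar> \<bar>ln R\<bar> + 2 * C / c"

lemma P_on: "P \<in> prob_on X" and N_on: "0 \<le> t \<Longrightarrow> N t \<in> prob_on X"
  using p n by (auto intro: dens_meas_prob_on)

lemma KL_prob_on_nonneg: "\<nu> \<in> prob_on X \<Longrightarrow> \<mu> \<in> prob_on X \<Longrightarrow> 0 \<le> KL \<nu> \<mu>"
  by (intro KL_nonneg) (simp_all add: prob_onD)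

lemma K_nonneg: "0 \<le> t \<Longrightarrow> 0 \<le> K t"
  unfolding K_def by (intro real_of_ereal_pos KL_prob_on_nonneg N_on P_on)

lemma n_pos:
  assumes t: "0 \<le> t" and x: "x \<in> X"
  shows "0 < n t x"
proof (rule entropic_ode_positive[where y="\<lambda>t. n t x" and f="\<lambda>t. f t x" and K=K, OF p_pos[OF x] _ c C _ _ _ t])
  have "0 < n 0 x / p x" using ratio[OF x] r by linarith
  then show "0 < n 0 x" using p_pos[OF x] by (simp add: zero_less_divide_iff)
qed (use ode[OF _ x] f_bound[OF _ x] K_nonneg in \<open>auto simp: K_def\<close>)

lemma l_deriv:
  assumes t: "0 \<le> t" and x: "x \<in> X"
  shows "((\<lambda>s. l s x) has_real_derivative - drift t x) (at t within {0..})"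
  unfolding l_def[abs_def] drift_def
  using ode[OF t x] n_pos[OF t x] p_pos[OF x]
  by (intro has_real_derivative_ln_ratio) (auto simp: K_def l_def)

lemma l0_bound: "x \<in> X \<Longrightarrow> \<bar>l 0 x\<bar> \<le> max \<bar>ln r\<bar> \<bar>ln R\<bar>"
proof -
  assume x: "x \<in> X"
  have "ln r \<le> l 0 x" "l 0 x \<le> ln R"
    unfolding l_def using ratio[OF x] r by (intro ln_mono; linarith)+
  then show ?thesis by linarith
qed

text \<open>The entropy \<open>K t\<close> is common to all points, so it cancels in differences of log-ratios.\<close>

lemma l_oscillation:
  assumes t: "0 \<le> t" and x: "x \<in> X" and y: "y \<in> X"
  shows "l t x - l t y \<le> B"
proof -
  have "l t x - l t y \<le> \<bar>l 0 x - l 0 y\<bar> + 2 * C / c"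
  proof (rule affine_growth_bound[OF t c])
    fix s assume s: "0 \<le> s" "s \<le> t"
    show "((\<lambda>s. l s x - l s y) has_real_derivative (- drift s x - - drift s y)) (at s within {0..t})"
      by (intro DERIV_diff DERIV_subset[OF l_deriv] s x y) auto
    show "- drift s x - - drift s y \<le> 2 * C - c * (l s x - l s y)"
      using f_bound[OF s(1) x] f_bound[OF s(1) y] by (simp add: drift_def algebra_simps)
  qed (use C in simp)
  with l0_bound[OF x] l0_bound[OF y] show ?thesis
    unfolding B_def by linarith
qed

lemma n_eq: "0 \<le> t \<Longrightarrow> x \<in> X \<Longrightarrow> n t x = p x * exp (l t x)"
  using n_pos[of t x] p_pos[of x] by (simp add: l_def)

text \<open>The oscillation bound compares the ratio of \<open>n t\<close> to \<open>p\<close> at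
  two points. As both densities have mass one, comparing them in either order bounds the ratio
  itself from above and from below.\<close>

lemma l_bound:
  assumes t: "0 \<le> t" and x: "x \<in> X"
  shows "\<bar>l t x\<bar> \<le> B"
proof -
  have *: "exp (l t x) \<le> exp B * exp (l t y)" if "x \<in> X" "y \<in> X" for x y
    using l_oscillation[OF t that] by (simp add: mult_exp_exp)
  have "n t x \<le> exp B * p x"
  proof (rule prob_density_ratio_le[OF n[OF t] p _ _ x])
    fix x y assume "x \<in> X" "y \<in> X"
    with *[of x y] p_pos[of x] p_pos[of y] show "n t x * p y \<le> exp B * (n t y * p x)"
      by (simp add: n_eq t mult_ac mult_left_mono)
  qed simp
  moreover have "p x \<le> exp B * n t x"
  proof (rule prob_density_ratio_le[OF p n[OF t] _ _ x])
    fix x y assume "x \<in> X" "y \<in> X"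
    with *[of y x] p_pos[of x] p_pos[of y] show "p x * n t y \<le> exp B * (p y * n t x)"
      by (simp add: n_eq t mult_ac mult_left_mono)
  qed simp
  ultimately have "exp (l t x) \<le> exp B" "1 \<le> exp B * exp (l t x)"
    using p_pos[OF x] by (simp_all add: n_eq[OF t x] mult_ac)
  then show ?thesis by (simp add: mult_exp_exp abs_le_iff)
qed

lemma l_measurable:
  assumes "0 \<le> t"
  shows "l t \<in> borel_measurable (restrict_space borel X)"
proof -
  have [measurable]: "n t \<in> borel_measurable (restrict_space borel X)" "p \<in> borel_measurable (restrict_space borel X)"
    using n[OF assms] p by (simp_all add: prob_density_on_def)
  show ?thesis unfolding l_def[abs_def] by measurable
qed

lemma l_integrable: 
  assumes t: "0 \<le> t" and \<nu>: "\<nu> \<in> prob_on X"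
  shows "integrable \<nu> (l t)"
proof -
  interpret prob_space \<nu> using prob_onD[OF \<nu>] by simp
  show ?thesis
    using l_measurable[OF t] l_bound[OF t]
    by (intro integrable_const_bound[where B=B]) (auto simp: prob_onD[OF \<nu>] prob_on_measurable_cong[OF \<nu>])
qed

section \<open>Divergences relative to the moving measure\<close>

lemma N_eq:
  assumes t: "0 \<le> t"
  shows "N t = density P (\<lambda>x. ennreal (exp (l t x)))"
proof -
  have m: "n t \<in> borel_measurable (restrict_space lborel X)" "p \<in> borel_measurable (restrict_space lborel X)"
    using n[OF t] p by (auto intro: prob_density_measurable)
  then have l: "l t \<in> borel_measurable (restrict_space lborel X)"
    by (simp add: l_def[abs_def])
  have "density P (\<lambda>x. ennreal (exp (l t x))) =
      density (restrict_space lborel X) (\<lambda>x. ennreal (p x) * ennreal (exp (l t x)))"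
    using m l unfolding dens_meas_def by (intro density_density_eq) auto
  also have "\<dots> = N t"
    unfolding dens_meas_def using m l p_pos
    by (intro density_cong AE_I2) (auto simp: space_restrict_space n_eq[OF t] ennreal_mult less_imp_le)
  finally show ?thesis ..
qed

text \<open>The flow is a bounded tilt of the fixed reference, so the time dependence of the
  divergence sits in the integral of a bounded function. The identity is extended-valued, so
  finiteness transfers as well.\<close>

lemma KL_P_eq:
  assumes t: "0 \<le> t" and \<nu>: "\<nu> \<in> prob_on X"
  shows "KL \<nu> P = KL \<nu> (N t) + ereal (\<integral>x. l t x \<partial>\<nu>)"
  unfolding N_eq[OF t]
  using l_bound[OF t] l_measurable[OF t] prob_onD[OF N_on[OF t]]
  by (intro KL_change_reference[where B=B])
     (simp_all add: prob_onD[OF \<nu>] prob_onD[OF P_on] prob_on_measurable_cong[OF P_on] N_eq[OF t, symmetric])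

lemma KL_N_finite_iff:
  assumes t: "0 \<le> t" and \<nu>: "\<nu> \<in> prob_on X"
  shows "KL \<nu> (N t) < \<infinity> \<longleftrightarrow> KL \<nu> P < \<infinity>"
  unfolding KL_P_eq[OF t \<nu>] by (cases "KL \<nu> (N t)") auto

lemma real_KL_N:
  assumes t: "0 \<le> t" and \<nu>: "\<nu> \<in> prob_on X" and fin: "KL \<nu> P < \<infinity>"
  shows "real_of_ereal (KL \<nu> (N t)) = real_of_ereal (KL \<nu> P) - (\<integral>x. l t x \<partial>\<nu>)"
  using fin KL_prob_on_nonneg[OF \<nu> N_on[OF t]] unfolding KL_P_eq[OF t \<nu>]
  by (cases "KL \<nu> (N t)") auto

text \<open>The divergence of \<open>N t\<close> from itself vanishes. In particular
  \<open>K t\<close> is a genuine finite divergence and not a default value of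
  \<open>real_of_ereal\<close>.\<close>

lemma KL_N_P: "0 \<le> t \<Longrightarrow> KL (N t) P = ereal (\<integral>x. l t x \<partial>N t)"
  by (simp add: KL_P_eq[OF _ N_on] KL_same prob_onD[OF N_on])

lemma K_eq: "0 \<le> t \<Longrightarrow> K t = (\<integral>x. l t x \<partial>N t)"
  by (simp add: K_def KL_N_P)

lemma K_le:
  assumes t: "0 \<le> t"
  shows "K t \<le> B"
proof -
  interpret prob_space "N t" using prob_onD[OF N_on[OF t]] by simp
  have "(\<integral>x. l t x \<partial>N t) \<le> (\<integral>x. B \<partial>N t)"
    using l_bound[OF t] by (intro integral_mono l_integrable t N_on) (auto simp: prob_onD[OF N_on[OF t]] abs_le_iff)
  then show ?thesis by (simp add: K_eq[OF t] prob_space)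
qed

lemma B_nonneg: "0 \<le> B"
  using C c by (simp add: B_def)

text \<open>This part of the drift does not contain \<open>f\<close>, so the bound can be reused
  when the opponent's measure is arbitrary.\<close>

lemma entropy_part_bound:
  assumes t: "0 \<le> t" and x: "x \<in> X"
  shows "\<bar>c * l t x - c * K t\<bar> \<le> 2 * c * B"
proof -
  have "\<bar>l t x - K t\<bar> \<le> 2 * B"
    using l_bound[OF t x] K_le[OF t] K_nonneg[OF t] by linarith
  then have "c * \<bar>l t x - K t\<bar> \<le> c * (2 * B)" using c by (intro mult_left_mono) auto
  with c show ?thesis by (simp add: abs_mult right_diff_distrib[symmetric])
qed

lemma drift_bound: "0 \<le> t \<Longrightarrow> x \<in> X \<Longrightarrow> \<bar>drift t x\<bar> \<le> C + 2 * c * B"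
  using f_bound[of t x] entropy_part_bound[of t x] by (simp add: drift_def)

section \<open>Time derivative of the divergence and a gap estimate\<close>

context
  fixes \<nu> assumes \<nu>: "\<nu> \<in> prob_on X"
begin

interpretation \<nu>: prob_space \<nu>
  using prob_onD[OF \<nu>] by simp

text \<open>Measurability is read off from the flow: minus the drift is the time derivative of the
  measurable functions \<open>l t\<close>, hence a limit of difference quotients. It is then
  inherited by the forcing.\<close>

lemma drift_measurable: "0 \<le> t \<Longrightarrow> drift t \<in> borel_measurable \<nu>"
proof -
  assume t: "0 \<le> t"
  have "(\<lambda>x. - drift t x) \<in> borel_measurable \<nu>"
    by (rule borel_measurable_time_derivative[where l=l and B=B and C="C + 2 * c * B"])
      (use t l_measurable l_bound l_deriv drift_bound in
        \<open>auto simp: prob_onD[OF \<nu>] prob_on_measurable_cong[OF \<nu>] \<nu>.finite_measure_axioms\<close>)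
  then show ?thesis by simp
qed

lemma f_integrable:
  assumes t: "0 \<le> t"
  shows "integrable \<nu> (f t)"
proof -
  have "(\<lambda>x. drift t x - c * l t x + c * K t) \<in> borel_measurable \<nu>"
    using drift_measurable[OF t] l_measurable[OF t]
    by (simp add: prob_on_measurable_cong[OF \<nu>])
  then have "f t \<in> borel_measurable \<nu>" by (simp add: drift_def)
  then show ?thesis
    using f_bound[OF t] by (intro \<nu>.integrable_const_bound[where B=C]) (auto simp: prob_onD[OF \<nu>])
qed

text \<open>Differentiating under the integral produces the mean of the drift. Rewriting the
  integral of \<open>l t\<close> as a difference of divergences exposes the term
  \<open>- c * real_of_ereal (KL \<nu> (N t))\<close>, the source of exponential decay.\<close>

lemma real_KL_N_deriv:
  assumes t: "0 \<le> t" and fin: "KL \<nu> P < \<infinity>"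
  shows "((\<lambda>s. real_of_ereal (KL \<nu> (N s))) has_real_derivative
    (\<integral>x. f t x \<partial>\<nu>) + c * (real_of_ereal (KL \<nu> P) - real_of_ereal (KL \<nu> (N t))) - c * K t) (at t within {0..})"
proof -
  have "((\<lambda>s. \<integral>x. l s x \<partial>\<nu>) has_real_derivative (\<integral>x. - drift t x \<partial>\<nu>)) (at t within {0..})"
    by (rule has_real_derivative_integral_bounded[where B=B and C="C + 2 * c * B"])
      (use t l_measurable l_bound l_deriv drift_bound in
        \<open>auto simp: prob_onD[OF \<nu>] prob_on_measurable_cong[OF \<nu>] \<nu>.finite_measure_axioms\<close>)
  from DERIV_diff[OF DERIV_const[of "real_of_ereal (KL \<nu> P)"] this]
  have "((\<lambda>s. real_of_ereal (KL \<nu> P) - (\<integral>x. l s x \<partial>\<nu>)) has_real_derivative (\<integral>x. drift t x \<partial>\<nu>)) (at t within {0..})"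
    by simp
  moreover have "(\<integral>x. drift t x \<partial>\<nu>) = (\<integral>x. f t x \<partial>\<nu>) + c * (\<integral>x. l t x \<partial>\<nu>) - c * K t"
    unfolding drift_def using f_integrable[OF t] l_integrable[OF t \<nu>]
    by (simp add: \<nu>.prob_space)
  moreover have "(\<integral>x. l t x \<partial>\<nu>) = real_of_ereal (KL \<nu> P) - real_of_ereal (KL \<nu> (N t))"
    using real_KL_N[OF t \<nu> fin] by simp
  ultimately have "((\<lambda>s. real_of_ereal (KL \<nu> P) - (\<integral>x. l s x \<partial>\<nu>)) has_real_derivative
     (\<integral>x. f t x \<partial>\<nu>) + c * (real_of_ereal (KL \<nu> P) - real_of_ereal (KL \<nu> (N t))) - c * K t) (at t within {0..})"
    by simp
  then show ?thesis
    by (rule has_field_derivative_transform_within[OF _ zero_less_one])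
       (use t real_KL_N[OF _ \<nu> fin] in auto)
qed

text \<open>Here \<open>g\<close> stands for a flat derivative, up to sign, at the flow against any
  opponent. Pinsker's inequality is applied to minus the drift built from \<open>g\<close>;
  expanding the integrals gives the left side plus \<open>c\<close> times
  \<open>KL \<nu> (N t)\<close>, a nonnegative term that is dropped.\<close>

lemma entropic_gap:
  assumes t: "0 \<le> t" and fin: "KL \<nu> P < \<infinity>"
    and g: "g \<in> borel_measurable (restrict_space borel X)"
    and bound: "\<And>x. x \<in> X \<Longrightarrow> \<bar>g x + c * l t x - c * K t\<bar> \<le> A" and A: "0 < A"
  shows "c * K t - c * real_of_ereal (KL \<nu> P) + (\<integral>x. g x \<partial>N t) - (\<integral>x. g x \<partial>\<nu>)
    \<le> A * sqrt (2 * real_of_ereal (KL \<nu> (N t)))"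
proof -
  interpret N: prob_space "N t" using prob_onD[OF N_on[OF t]] by simp
  let ?h = "\<lambda>x. - (g x + c * l t x - c * K t)"
  have gb: "\<bar>g x\<bar> \<le> A + 2 * c * B" if "x \<in> X" for x
    using bound[OF that] entropy_part_bound[OF t that] by linarith
  have gi: "integrable \<nu> g" "integrable (N t) g"
    using g gb
    by (auto intro!: \<nu>.integrable_const_bound[where B="A + 2 * c * B"] N.integrable_const_bound[where B="A + 2 * c * B"]
      simp: prob_onD[OF \<nu>] prob_onD[OF N_on[OF t]] prob_on_measurable_cong[OF \<nu>] prob_on_measurable_cong[OF N_on[OF t]])
  note li = l_integrable[OF t \<nu>] l_integrable[OF t N_on[OF t]]
  have "(\<integral>x. ?h x \<partial>\<nu>) - (\<integral>x. ?h x \<partial>N t) \<le> A * sqrt (2 * real_of_ereal (KL \<nu> (N t)))"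
    using g l_measurable[OF t] bound fin[folded KL_N_finite_iff[OF t \<nu>]]
    by (intro Pinsker_dual A)
       (auto simp: prob_onD[OF \<nu>] prob_onD[OF N_on[OF t]] prob_on_measurable_cong[OF N_on[OF t]] abs_minus_commute)
  moreover have "(\<integral>x. ?h x \<partial>\<nu>) = - (\<integral>x. g x \<partial>\<nu>) - c * (\<integral>x. l t x \<partial>\<nu>) + c * K t"
    using gi li by (simp add: \<nu>.prob_space)
  moreover have "(\<integral>x. ?h x \<partial>N t) = - (\<integral>x. g x \<partial>N t) - c * (\<integral>x. l t x \<partial>N t) + c * K t"
    using gi li by (simp add: N.prob_space)
  moreover have "c * (\<integral>x. l t x \<partial>\<nu>) = c * real_of_ereal (KL \<nu> P) - c * real_of_ereal (KL \<nu> (N t))"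
    using real_KL_N[OF t \<nu> fin] by (simp add: right_diff_distrib)
  moreover have "0 \<le> c * real_of_ereal (KL \<nu> (N t))"
    using c KL_prob_on_nonneg[OF \<nu> N_on[OF t]] by (simp add: real_of_ereal_pos)
  ultimately show ?thesis by (simp add: K_eq[OF t])
qed

end

end

section \<open>The game\<close>

lemma gibbs_density_pos:
  assumes "prob_density_on X (gibbs_density X U)"
  shows "0 < gibbs_density X U x"
proof -
  define Z where "Z = (\<integral>z. exp (- U z) \<partial>(restrict_space lborel X))"
  \<comment> \<open>Division by zero would make the density identically zero, against total mass
    one.\<close>
  have "Z \<noteq> 0"
  proof
    assume "Z = 0"
    then have "gibbs_density X U = (\<lambda>_. 0)"
      by (simp add: gibbs_density_def[abs_def] Z_def)
    with nn_integral_prob_density[OF assms] show False by simp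
  qed
  moreover have "0 \<le> Z" unfolding Z_def by (intro integral_nonneg_AE) auto
  ultimately show ?thesis unfolding gibbs_density_def Z_def[symmetric] by simp
qed

lemma topspace_weak_topology: "topspace (weak_topology M) = prob_on M"
proof -
  let ?T = "{{m \<in> prob_on M. (\<integral>x. f x \<partial>m) \<in> S} | (f :: 'a \<Rightarrow> real) S.
        continuous_on M f \<and> bounded (f ` M) \<and> open S}"
  \<comment> \<open>A constant function with unrestricted target exhibits all of
    \<open>prob_on M\<close> as a single generating set.\<close>
  have "{m \<in> prob_on M. (\<integral>x. 0 \<partial>m) \<in> (UNIV :: real set)} \<in> ?T"
  proof (intro CollectI exI[of _ "\<lambda>_. 0 :: real"] exI[of _ "UNIV :: real set"] conjI)
    show "bounded ((\<lambda>_. 0 :: real) ` M)" by (rule bounded_subset[of "{0}"]) auto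
  qed auto
  then have "prob_on M \<subseteq> \<Union>?T" by (auto dest: Union_upper)
  moreover have "\<Union>?T \<subseteq> prob_on M" by blast
  ultimately show ?thesis
    unfolding weak_topology_def topology_generated_by_topspace by (rule subset_antisym[rotated])
qed

text \<open>Fixing the measure in a jointly continuous map leaves a continuous function of the
  point. This supplies measurability against arbitrary opponents, where the flow equation gives no
  information.\<close>

lemma flat_derivative_measurable:
  assumes "has_flat_derivative M G g" and m: "m \<in> prob_on M"
  shows "g m \<in> borel_measurable (restrict_space borel M)"
proof -
  have "continuous_map (top_of_set M) (prod_topology (weak_topology M) (top_of_set M)) (\<lambda>x. (m, x))"
    using m by (simp add: continuous_map_pairwise o_def topspace_weak_topology)
  moreover have "continuous_map (prod_topology (weak_topology M) (top_of_set M)) euclideanreal (\<lambda>(m, x). g m x)"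
    using assms by (simp add: has_flat_derivative_def)
  ultimately have "continuous_map (top_of_set M) euclideanreal ((\<lambda>(m, x). g m x) \<circ> (\<lambda>x. (m, x)))"
    by (rule continuous_map_compose)
  then have "continuous_on M (g m)" by (simp add: o_def)
  then show ?thesis by (rule borel_measurable_continuous_on_restrict)
qed

lemma flat_derivative_mean_zero:
  "has_flat_derivative M G g \<Longrightarrow> m \<in> prob_on M \<Longrightarrow> (\<integral>x. g m x \<partial>m) = 0"
  by (simp add: has_flat_derivative_def)

text \<open>An instance of the arithmetic-geometric mean inequality; the factor 2 in the estimate of
  the Nikaido-Isoda error comes from here.\<close>

lemma sqrt_two_add_le:
  assumes "0 \<le> a" "0 \<le> b"
  shows "sqrt (2 * a) + sqrt (2 * b) \<le> 2 * sqrt (a + b)"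
proof -
  have "(sqrt (2 * a) + sqrt (2 * b))\<^sup>2 \<le> (2 * sqrt (a + b))\<^sup>2"
    using assms sum_squares_bound[of "sqrt (2 * a)" "sqrt (2 * b)"] by (simp add: power2_sum)
  then show ?thesis by (rule power2_le_imp_le) (use assms in simp)
qed

section \<open>The coupled flow of both players\<close>

locale fisher_rao_game =
  fixes X Y :: "'a::euclidean_space set"
    and U\<^sub>\<pi> U\<^sub>\<rho> :: "'a \<Rightarrow> real"
    and F :: "'a measure \<Rightarrow> 'a measure \<Rightarrow> real"
    and \<sigma> :: real
    and F\<^sub>\<nu> F\<^sub>\<mu> :: "'a measure \<Rightarrow> 'a measure \<Rightarrow> 'a \<Rightarrow> real"
    and C\<^sub>\<nu> C\<^sub>\<mu> r\<^sub>\<nu> r\<^sub>\<mu> R\<^sub>\<nu> R\<^sub>\<mu> :: real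
    and n m :: "real \<Rightarrow> 'a \<Rightarrow> real"
  assumes gibbs: "prob_density_on X (gibbs_density X U\<^sub>\<pi>)" "prob_density_on Y (gibbs_density Y U\<^sub>\<rho>)"
    and \<sigma>: "0 < \<sigma>"
    and flat\<^sub>\<nu>: "\<And>\<mu>. \<mu> \<in> prob_on Y \<Longrightarrow> has_flat_derivative X (\<lambda>\<nu>. F \<nu> \<mu>) (\<lambda>\<nu>. F\<^sub>\<nu> \<nu> \<mu>)"
    and flat\<^sub>\<mu>: "\<And>\<nu>. \<nu> \<in> prob_on X \<Longrightarrow> has_flat_derivative Y (\<lambda>\<mu>. F \<nu> \<mu>) (\<lambda>\<mu>. F\<^sub>\<mu> \<nu> \<mu>)"
    and C_pos: "0 < C\<^sub>\<nu>" "0 < C\<^sub>\<mu>"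
    and F\<^sub>\<nu>_bound: "\<And>\<nu> \<mu> x. \<nu> \<in> prob_on X \<Longrightarrow> \<mu> \<in> prob_on Y \<Longrightarrow> x \<in> X \<Longrightarrow> \<bar>F\<^sub>\<nu> \<nu> \<mu> x\<bar> \<le> C\<^sub>\<nu>"
    and F\<^sub>\<mu>_bound: "\<And>\<nu> \<mu> y. \<nu> \<in> prob_on X \<Longrightarrow> \<mu> \<in> prob_on Y \<Longrightarrow> y \<in> Y \<Longrightarrow> \<bar>F\<^sub>\<mu> \<nu> \<mu> y\<bar> \<le> C\<^sub>\<mu>"
    and flow: "fisher_rao_flow X Y U\<^sub>\<pi> U\<^sub>\<rho> F\<^sub>\<nu> F\<^sub>\<mu> \<sigma> n m"
    and r_pos: "0 < r\<^sub>\<nu>" "0 < r\<^sub>\<mu>"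
    and ratio\<^sub>\<nu>: "\<And>x. x \<in> X \<Longrightarrow> r\<^sub>\<nu> \<le> n 0 x / gibbs_density X U\<^sub>\<pi> x"
      "\<And>x. x \<in> X \<Longrightarrow> n 0 x / gibbs_density X U\<^sub>\<pi> x \<le> R\<^sub>\<nu>"
    and ratio\<^sub>\<mu>: "\<And>y. y \<in> Y \<Longrightarrow> r\<^sub>\<mu> \<le> m 0 y / gibbs_density Y U\<^sub>\<rho> y"
      "\<And>y. y \<in> Y \<Longrightarrow> m 0 y / gibbs_density Y U\<^sub>\<rho> y \<le> R\<^sub>\<mu>"
begin

abbreviation "c \<equiv> \<sigma>\<^sup>2 / 2"

lemma c_pos: "0 < c" using \<sigma> by simp

lemma flow_densities:
  "0 \<le> t \<Longrightarrow> prob_density_on X (n t)" "0 \<le> t \<Longrightarrow> prob_density_on Y (m t)"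
  using flow by (simp_all add: fisher_rao_flow_def)

text \<open>The maximising player minimises \<open>- F\<close>.\<close>

sublocale x: entropic_flow X "gibbs_density X U\<^sub>\<pi>" n
  "\<lambda>t. F\<^sub>\<nu> (dens_meas X (n t)) (dens_meas Y (m t))" "\<sigma>\<^sup>2 / 2" C\<^sub>\<nu> r\<^sub>\<nu> R\<^sub>\<nu>
proof
  show "((\<lambda>s. n s x) has_real_derivative
      - (F\<^sub>\<nu> (dens_meas X (n t)) (dens_meas Y (m t)) x + c * ln (n t x / gibbs_density X U\<^sub>\<pi> x)
         - c * real_of_ereal (KL (dens_meas X (n t)) (gibbs X U\<^sub>\<pi>))) * n t x) (at t within {0..})"
    if "0 \<le> t" "x \<in> X" for t x
    using flow that by (simp add: fisher_rao_flow_def drift_a_def)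
qed (use gibbs gibbs_density_pos[OF gibbs(1)] c_pos C_pos flow_densities r_pos ratio\<^sub>\<nu> in
  \<open>auto intro!: F\<^sub>\<nu>_bound dens_meas_prob_on\<close>)

sublocale y: entropic_flow Y "gibbs_density Y U\<^sub>\<rho>" m
  "\<lambda>t y. - F\<^sub>\<mu> (dens_meas X (n t)) (dens_meas Y (m t)) y" "\<sigma>\<^sup>2 / 2" C\<^sub>\<mu> r\<^sub>\<mu> R\<^sub>\<mu>
proof
  show "((\<lambda>s. m s y) has_real_derivative
      - (- F\<^sub>\<mu> (dens_meas X (n t)) (dens_meas Y (m t)) y + c * ln (m t y / gibbs_density Y U\<^sub>\<rho> y)
         - c * real_of_ereal (KL (dens_meas Y (m t)) (gibbs Y U\<^sub>\<rho>))) * m t y) (at t within {0..})"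
    if "0 \<le> t" "y \<in> Y" for t y
    using flow that by (simp add: fisher_rao_flow_def drift_b_def algebra_simps)
qed (use gibbs gibbs_density_pos[OF gibbs(2)] c_pos C_pos flow_densities r_pos ratio\<^sub>\<mu> in
  \<open>auto intro!: F\<^sub>\<mu>_bound dens_meas_prob_on\<close>)

abbreviation "V \<equiv> game_value F (gibbs X U\<^sub>\<pi>) (gibbs Y U\<^sub>\<rho>) \<sigma>"

lemma drift_a_eq: "drift_a X U\<^sub>\<pi> F\<^sub>\<nu> \<sigma> (n t) \<mu> x = F\<^sub>\<nu> (x.N t) \<mu> x + c * x.l t x - c * x.K t"
  by (simp add: drift_a_def x.l_def x.K_def)

lemma drift_b_eq: "- drift_b Y U\<^sub>\<rho> F\<^sub>\<mu> \<sigma> \<nu> (m t) y = - F\<^sub>\<mu> \<nu> (y.N t) y + c * y.l t y - c * y.K t"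
  by (simp add: drift_b_def y.l_def y.K_def)

text \<open>The opponent's measure enters only through the flat derivative, whose bound is uniform;
  the remaining terms are controlled by \<open>entropy_part_bound\<close>.\<close>

lemma drift_a_bounded:
  "\<exists>A>0. \<forall>t\<ge>0. \<forall>\<mu>\<in>prob_on Y. \<forall>x\<in>X. \<bar>drift_a X U\<^sub>\<pi> F\<^sub>\<nu> \<sigma> (n t) \<mu> x\<bar> \<le> A"
proof (intro exI[of _ "C\<^sub>\<nu> + 2 * c * x.B"] conjI allI impI ballI)
  show "0 < C\<^sub>\<nu> + 2 * c * x.B"
    using C_pos(1) c_pos x.B_nonneg by (intro add_pos_nonneg mult_nonneg_nonneg) auto
  fix t :: real and \<mu> x assume "0 \<le> t" "\<mu> \<in> prob_on Y" "x \<in> X"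
  then show "\<bar>drift_a X U\<^sub>\<pi> F\<^sub>\<nu> \<sigma> (n t) \<mu> x\<bar> \<le> C\<^sub>\<nu> + 2 * c * x.B"
    using F\<^sub>\<nu>_bound[OF x.N_on, of t \<mu> x] x.entropy_part_bound[of t x] unfolding drift_a_eq by linarith
qed

lemma drift_b_bounded:
  "\<exists>A>0. \<forall>t\<ge>0. \<forall>\<nu>\<in>prob_on X. \<forall>y\<in>Y. \<bar>drift_b Y U\<^sub>\<rho> F\<^sub>\<mu> \<sigma> \<nu> (m t) y\<bar> \<le> A"
proof (intro exI[of _ "C\<^sub>\<mu> + 2 * c * y.B"] conjI allI impI ballI)
  show "0 < C\<^sub>\<mu> + 2 * c * y.B"
    using C_pos(2) c_pos y.B_nonneg by (intro add_pos_nonneg mult_nonneg_nonneg) auto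
  fix t :: real and \<nu> y assume "0 \<le> t" "\<nu> \<in> prob_on X" "y \<in> Y"
  then show "\<bar>drift_b Y U\<^sub>\<rho> F\<^sub>\<mu> \<sigma> \<nu> (m t) y\<bar> \<le> C\<^sub>\<mu> + 2 * c * y.B"
    using F\<^sub>\<mu>_bound[OF _ y.N_on, of \<nu> t y] y.entropy_part_bound[of t y] drift_b_eq[of \<nu> t y] by linarith
qed

text \<open>Finiteness relative to the flow is equivalent to finiteness relative to the Gibbs
  references, which do not depend on time. Hence the same alternative holds at all times.\<close>

lemma KL_sum_dichotomy:
  assumes \<nu>: "\<nu> \<in> prob_on X" and \<mu>: "\<mu> \<in> prob_on Y"
  shows "if KL \<nu> (x.N 0) + KL \<mu> (y.N 0) < \<infinity>
    then (\<forall>t\<ge>0. KL \<nu> (x.N t) + KL \<mu> (y.N t) < \<infinity>) \<and>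
      (\<lambda>t. real_of_ereal (KL \<nu> (x.N t) + KL \<mu> (y.N t))) differentiable_on {0..}
    else (\<forall>t\<ge>0. KL \<nu> (x.N t) + KL \<mu> (y.N t) = \<infinity>)"
proof -
  have iff: "KL \<nu> (x.N t) + KL \<mu> (y.N t) < \<infinity> \<longleftrightarrow> KL \<nu> x.P < \<infinity> \<and> KL \<mu> y.P < \<infinity>" if "0 \<le> t" for t
    using x.KL_N_finite_iff[OF that \<nu>] y.KL_N_finite_iff[OF that \<mu>] by auto
  show ?thesis
  proof (cases "KL \<nu> x.P < \<infinity> \<and> KL \<mu> y.P < \<infinity>")
    case True
    have eq: "real_of_ereal (KL \<nu> (x.N t)) + real_of_ereal (KL \<mu> (y.N t)) = real_of_ereal (KL \<nu> (x.N t) + KL \<mu> (y.N t))"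
      if "t \<in> {0..}" for t
      using that True x.KL_N_finite_iff[OF _ \<nu>, of t] y.KL_N_finite_iff[OF _ \<mu>, of t]
        x.KL_prob_on_nonneg[OF \<nu> x.N_on, of t] y.KL_prob_on_nonneg[OF \<mu> y.N_on, of t]
      by (cases "KL \<nu> (x.N t)"; cases "KL \<mu> (y.N t)") auto
    have "\<exists>D. ((\<lambda>t. real_of_ereal (KL \<nu> (x.N t) + KL \<mu> (y.N t))) has_real_derivative D) (at t within {0..})"
      if t: "0 \<le> t" for t
    proof
      note deriv = DERIV_add[OF x.real_KL_N_deriv[OF \<nu> t] y.real_KL_N_deriv[OF \<mu> t]]
      show "((\<lambda>t. real_of_ereal (KL \<nu> (x.N t) + KL \<mu> (y.N t))) has_real_derivative
        ((\<integral>x. F\<^sub>\<nu> (x.N t) (y.N t) x \<partial>\<nu>) + c * (real_of_ereal (KL \<nu> x.P) - real_of_ereal (KL \<nu> (x.N t))) - c * x.K t)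
        + ((\<integral>y. - F\<^sub>\<mu> (x.N t) (y.N t) y \<partial>\<mu>) + c * (real_of_ereal (KL \<mu> y.P) - real_of_ereal (KL \<mu> (y.N t))) - c * y.K t))
        (at t within {0..})"
        using True t by (intro has_field_derivative_transform_within[OF deriv zero_less_one _ eq]) auto
    qed
    then have "(\<lambda>t. real_of_ereal (KL \<nu> (x.N t) + KL \<mu> (y.N t))) differentiable_on {0..}"
      by (auto simp: differentiable_on_def real_differentiable_def)
    with True iff show ?thesis by simp
  next
    case False
    have "KL \<nu> (x.N t) + KL \<mu> (y.N t) = \<infinity>" if "0 \<le> t" for t
      using iff[OF that] False by auto
    then show ?thesis by simp
  qed
qed

section \<open>Extended-real values of the game\<close>

lemma game_value_real:
  assumes "\<nu> \<in> prob_on X" "\<mu> \<in> prob_on Y" "KL \<nu> x.P < \<infinity>" "KL \<mu> y.P < \<infinity>"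
  shows "V \<nu> \<mu> = ereal (F \<nu> \<mu> + c * (real_of_ereal (KL \<nu> x.P) - real_of_ereal (KL \<mu> y.P)))"
  using assms x.KL_prob_on_nonneg[OF assms(1) x.P_on] y.KL_prob_on_nonneg[OF assms(2) y.P_on]
  by (cases "KL \<nu> x.P"; cases "KL \<mu> y.P") (auto simp: game_value_def)

text \<open>In \<open>ereal\<close>, infinity minus anything is infinity, also when
  \<open>KL \<mu> y.P\<close> is infinite.\<close>

lemma game_value_infinite: "KL \<nu> x.P = \<infinity> \<Longrightarrow> V \<nu> \<mu> = \<infinity>"
  using c_pos by (simp add: game_value_def)

lemma game_value_neg_infinite: "KL \<nu> x.P < \<infinity> \<Longrightarrow> KL \<mu> y.P = \<infinity> \<Longrightarrow> V \<nu> \<mu> = - \<infinity>"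
  using c_pos by (cases "KL \<nu> x.P") (simp_all add: game_value_def)

lemma KL_N_P_finite: "0 \<le> t \<Longrightarrow> KL (x.N t) x.P < \<infinity>" "0 \<le> t \<Longrightarrow> KL (y.N t) y.P < \<infinity>"
  by (simp_all add: x.KL_N_P y.KL_N_P)

lemma equilibrium_KL_finite:
  assumes "mixed_nash X Y V \<nu>s \<mu>s"
  shows "KL \<nu>s x.P < \<infinity>" "KL \<mu>s y.P < \<infinity>"
proof -
  \<comment> \<open>Both players deviate to the Gibbs references, whose divergence is zero. An
    infinite divergence of \<open>\<nu>s\<close> would make the left side infinite; with that
    excluded, one of \<open>\<mu>s\<close> would make the right side minus infinity.\<close>
  have on: "\<nu>s \<in> prob_on X" "\<mu>s \<in> prob_on Y" and le: "V \<nu>s y.P \<le> V x.P \<mu>s"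
    using assms x.P_on y.P_on unfolding mixed_nash_def by (auto intro: order_trans)
  have self: "KL x.P x.P = 0" "KL y.P y.P = 0"
    by (simp_all add: KL_same prob_onD[OF x.P_on] prob_onD[OF y.P_on])
  show fin: "KL \<nu>s x.P < \<infinity>"
  proof (rule ccontr)
    assume "\<not> KL \<nu>s x.P < \<infinity>"
    with le have "V x.P \<mu>s = \<infinity>" by (simp add: game_value_infinite)
    then show False
      using self game_value_neg_infinite[of x.P \<mu>s] game_value_real[OF x.P_on on(2)]
      by (cases "KL \<mu>s y.P = \<infinity>") auto
  qed
  show "KL \<mu>s y.P < \<infinity>"
  proof (rule ccontr)
    assume "\<not> KL \<mu>s y.P < \<infinity>"
    with le self have "V \<nu>s y.P = - \<infinity>" by (simp add: game_value_neg_infinite)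
    then show False
      using game_value_real[OF on(1) y.P_on fin] self by auto
  qed
qed

section \<open>Convergence to an equilibrium in the convex-concave case\<close>

context
  fixes \<nu>s \<mu>s
  assumes cc: "convex_concave X Y F F\<^sub>\<nu> F\<^sub>\<mu>" and nash: "mixed_nash X Y V \<nu>s \<mu>s"
begin

lemma equilibrium_on: "\<nu>s \<in> prob_on X" "\<mu>s \<in> prob_on Y"
  using nash by (auto simp: mixed_nash_def)

lemma equilibrium_le: "\<nu> \<in> prob_on X \<Longrightarrow> \<mu> \<in> prob_on Y \<Longrightarrow> V \<nu>s \<mu> \<le> V \<nu> \<mu>s"
  using nash unfolding mixed_nash_def by (blast intro: order_trans)

lemma convex: "\<nu> \<in> prob_on X \<Longrightarrow> \<mu> \<in> prob_on Y \<Longrightarrow>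
    (\<integral>x. F\<^sub>\<nu> \<nu> \<mu> x \<partial>\<nu>s) - (\<integral>x. F\<^sub>\<nu> \<nu> \<mu> x \<partial>\<nu>) \<le> F \<nu>s \<mu> - F \<nu> \<mu>"
  and concave: "\<nu> \<in> prob_on X \<Longrightarrow> \<mu> \<in> prob_on Y \<Longrightarrow>
    F \<nu> \<mu>s - F \<nu> \<mu> \<le> (\<integral>y. F\<^sub>\<mu> \<nu> \<mu> y \<partial>\<mu>s) - (\<integral>y. F\<^sub>\<mu> \<nu> \<mu> y \<partial>\<mu>)"
  using cc equilibrium_on unfolding convex_concave_def by blast+

definition "lyapunov t = real_of_ereal (KL \<nu>s (x.N t)) + real_of_ereal (KL \<mu>s (y.N t))"

lemmas KL_fin = equilibrium_KL_finite[OF nash]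

lemma KL_sum_eq: "0 \<le> t \<Longrightarrow> KL \<nu>s (x.N t) + KL \<mu>s (y.N t) = ereal (lyapunov t)"
  using x.KL_N_finite_iff[OF _ equilibrium_on(1), of t] y.KL_N_finite_iff[OF _ equilibrium_on(2), of t] KL_fin
    x.KL_prob_on_nonneg[OF equilibrium_on(1) x.N_on, of t] y.KL_prob_on_nonneg[OF equilibrium_on(2) y.N_on, of t]
  unfolding lyapunov_def
  by (cases "KL \<nu>s (x.N t)"; cases "KL \<mu>s (y.N t)") auto

lemma lyapunov_decay:
  assumes T: "0 \<le> T"
  shows "lyapunov T \<le> exp (- c * T) * lyapunov 0"
proof (rule exponential_decay[OF T])
  fix t assume t: "0 \<le> t" "t \<le> T"
  let ?N = "x.N t" and ?M = "y.N t"
  let ?dx = "(\<integral>x. F\<^sub>\<nu> ?N ?M x \<partial>\<nu>s) + c * (real_of_ereal (KL \<nu>s x.P) - real_of_ereal (KL \<nu>s ?N)) - c * x.K t"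
  let ?dy = "(\<integral>y. - F\<^sub>\<mu> ?N ?M y \<partial>\<mu>s) + c * (real_of_ereal (KL \<mu>s y.P) - real_of_ereal (KL \<mu>s ?M)) - c * y.K t"
  show "(lyapunov has_real_derivative ?dx + ?dy) (at t within {0..T})"
    unfolding lyapunov_def[abs_def]
    by (intro DERIV_add DERIV_subset[OF x.real_KL_N_deriv[OF equilibrium_on(1) t(1) KL_fin(1)]]
      DERIV_subset[OF y.real_KL_N_deriv[OF equilibrium_on(2) t(1) KL_fin(2)]]) auto
  note on = x.N_on[OF t(1)] y.N_on[OF t(1)]
  \<comment> \<open>The flow measures serve as the deviations of both players.\<close>
  have "V \<nu>s ?M \<le> V ?N \<mu>s" using on by (rule equilibrium_le)
  then have "F \<nu>s ?M + c * (real_of_ereal (KL \<nu>s x.P) - y.K t) \<le> F ?N \<mu>s + c * (x.K t - real_of_ereal (KL \<mu>s y.P))"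
    using KL_fin KL_N_P_finite[OF t(1)] on equilibrium_on
    by (simp add: game_value_real x.K_def y.K_def)
  \<comment> \<open>The flat derivative at the flow has mean zero under \<open>?N\<close> itself, so
    only its integral against the equilibrium measure survives in the convexity inequality.\<close>
  moreover have "(\<integral>x. F\<^sub>\<nu> ?N ?M x \<partial>\<nu>s) \<le> F \<nu>s ?M - F ?N ?M"
    using convex[OF on] flat_derivative_mean_zero[OF flat\<^sub>\<nu>[OF on(2)] on(1)] by simp
  moreover have "F ?N \<mu>s - F ?N ?M \<le> (\<integral>y. F\<^sub>\<mu> ?N ?M y \<partial>\<mu>s)"
    using concave[OF on] flat_derivative_mean_zero[OF flat\<^sub>\<mu>[OF on(1)] on(2)] by simp
  \<comment> \<open>Adding the three inequalities cancels all values of \<open>F\<close> and all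
    divergences from the Gibbs references, leaving the decay term.\<close>
  ultimately show "?dx + ?dy \<le> - c * lyapunov t"
    by (simp add: lyapunov_def algebra_simps)
qed

lemma nikaido_isoda_le:
  assumes t: "0 \<le> t" and A: "0 < A\<^sub>1" "0 < A\<^sub>2"
    and a: "\<And>\<mu> x. \<mu> \<in> prob_on Y \<Longrightarrow> x \<in> X \<Longrightarrow> \<bar>drift_a X U\<^sub>\<pi> F\<^sub>\<nu> \<sigma> (n t) \<mu> x\<bar> \<le> A\<^sub>1"
    and b: "\<And>\<nu> y. \<nu> \<in> prob_on X \<Longrightarrow> y \<in> Y \<Longrightarrow> \<bar>drift_b Y U\<^sub>\<rho> F\<^sub>\<mu> \<sigma> \<nu> (m t) y\<bar> \<le> A\<^sub>2"
  shows "nikaido_isoda X Y V (x.N t) (y.N t)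
    \<le> ereal (A\<^sub>1 * sqrt (2 * real_of_ereal (KL \<nu>s (x.N t))) + A\<^sub>2 * sqrt (2 * real_of_ereal (KL \<mu>s (y.N t))))"
proof -
  let ?N = "x.N t" and ?M = "y.N t"
  let ?ex = "A\<^sub>1 * sqrt (2 * real_of_ereal (KL \<nu>s ?N))" and ?ey = "A\<^sub>2 * sqrt (2 * real_of_ereal (KL \<mu>s ?M))"
  note on = x.N_on[OF t] y.N_on[OF t]
  \<comment> \<open>The equilibrium value is inserted between the supremum and the infimum; each
    best response improves on it by at most one Pinsker term.\<close>
  obtain v where v: "V \<nu>s \<mu>s = ereal v"
    using game_value_real[OF equilibrium_on KL_fin] by blast
  have "(SUP \<mu>\<in>prob_on Y. V ?N \<mu>) \<le> ereal (v + ?ex)"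
  proof (rule SUP_least)
    fix \<mu> assume \<mu>: "\<mu> \<in> prob_on Y"
    show "V ?N \<mu> \<le> ereal (v + ?ex)"
    proof (cases "KL \<mu> y.P < \<infinity>")
      case True
      have "V \<nu>s \<mu> \<le> ereal v"
        using nash \<mu> v by (auto simp: mixed_nash_def)
      then have "F \<nu>s \<mu> + c * (real_of_ereal (KL \<nu>s x.P) - real_of_ereal (KL \<mu> y.P)) \<le> v"
        by (simp add: game_value_real[OF equilibrium_on(1) \<mu> KL_fin(1) True])
      moreover have "c * x.K t - c * real_of_ereal (KL \<nu>s x.P) + (\<integral>x. F\<^sub>\<nu> ?N \<mu> x \<partial>?N) - (\<integral>x. F\<^sub>\<nu> ?N \<mu> x \<partial>\<nu>s) \<le> ?ex"
        using a[OF \<mu>] flat_derivative_measurable[OF flat\<^sub>\<nu>[OF \<mu>] on(1)]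
        by (intro x.entropic_gap equilibrium_on t KL_fin A) (simp_all add: drift_a_eq)
      ultimately show ?thesis
        using convex[OF on(1) \<mu>]
        by (simp add: game_value_real[OF on(1) \<mu> KL_N_P_finite(1)[OF t] True] x.K_def algebra_simps)
    next
      case False
      \<comment> \<open>A response of infinite divergence has value minus infinity and cannot raise
        the supremum.\<close>
      then show ?thesis using game_value_neg_infinite[OF KL_N_P_finite(1)[OF t]] by simp
    qed
  qed
  moreover have "ereal (v - ?ey) \<le> (INF \<nu>\<in>prob_on X. V \<nu> ?M)"
  proof (rule INF_greatest)
    fix \<nu> assume \<nu>: "\<nu> \<in> prob_on X"
    show "ereal (v - ?ey) \<le> V \<nu> ?M"
    proof (cases "KL \<nu> x.P < \<infinity>")
      case True
      have "ereal v \<le> V \<nu> \<mu>s"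
        using nash \<nu> v by (auto simp: mixed_nash_def)
      then have le: "v \<le> F \<nu> \<mu>s + c * (real_of_ereal (KL \<nu> x.P) - real_of_ereal (KL \<mu>s y.P))"
        by (simp add: game_value_real[OF \<nu> equilibrium_on(2) True KL_fin(2)])
      \<comment> \<open>The one-player estimate for the maximiser takes minus the flat derivative,
        and the bound on \<open>drift_b\<close> is insensitive to this sign.\<close>
      have bound: "\<bar>- F\<^sub>\<mu> \<nu> ?M y + c * y.l t y - c * y.K t\<bar> \<le> A\<^sub>2" if "y \<in> Y" for y
        using b[OF \<nu> that] by (simp only: drift_b_eq[symmetric] abs_minus_cancel)
      have "c * y.K t - c * real_of_ereal (KL \<mu>s y.P) + (\<integral>y. - F\<^sub>\<mu> \<nu> ?M y \<partial>?M) - (\<integral>y. - F\<^sub>\<mu> \<nu> ?M y \<partial>\<mu>s) \<le> ?ey"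
        using flat_derivative_measurable[OF flat\<^sub>\<mu>[OF \<nu>] on(2)]
        by (intro y.entropic_gap equilibrium_on t KL_fin A bound) simp_all
      then show ?thesis
        using le concave[OF \<nu> on(2)]
        by (simp add: game_value_real[OF \<nu> on(2) True KL_N_P_finite(2)[OF t]] y.K_def algebra_simps)
    next
      case False
      then show ?thesis using game_value_infinite by simp
    qed
  qed
  ultimately have "nikaido_isoda X Y V ?N ?M \<le> ereal (v + ?ex) - ereal (v - ?ey)"
    unfolding nikaido_isoda_def by (rule ereal_minus_mono)
  then show ?thesis by simp
qed

lemma nikaido_isoda_decay:
  assumes t: "0 \<le> t" and A: "0 < A\<^sub>1" "0 < A\<^sub>2"
    and a: "\<And>\<mu> x. \<mu> \<in> prob_on Y \<Longrightarrow> x \<in> X \<Longrightarrow> \<bar>drift_a X U\<^sub>\<pi> F\<^sub>\<nu> \<sigma> (n t) \<mu> x\<bar> \<le> A\<^sub>1"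
    and b: "\<And>\<nu> y. \<nu> \<in> prob_on X \<Longrightarrow> y \<in> Y \<Longrightarrow> \<bar>drift_b Y U\<^sub>\<rho> F\<^sub>\<mu> \<sigma> \<nu> (m t) y\<bar> \<le> A\<^sub>2"
  shows "nikaido_isoda X Y V (x.N t) (y.N t)
    \<le> ereal (2 * max A\<^sub>1 A\<^sub>2 * exp (- (\<sigma>\<^sup>2 / 4) * t) * sqrt (lyapunov 0))"
proof -
  let ?A = "max A\<^sub>1 A\<^sub>2"
  let ?kx = "real_of_ereal (KL \<nu>s (x.N t))" and ?ky = "real_of_ereal (KL \<mu>s (y.N t))"
  have k: "0 \<le> ?kx" "0 \<le> ?ky"
    using x.KL_prob_on_nonneg[OF equilibrium_on(1) x.N_on[OF t]] y.KL_prob_on_nonneg[OF equilibrium_on(2) y.N_on[OF t]]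
    by (simp_all add: real_of_ereal_pos)
  have "A\<^sub>1 * sqrt (2 * ?kx) + A\<^sub>2 * sqrt (2 * ?ky) \<le> ?A * sqrt (2 * ?kx) + ?A * sqrt (2 * ?ky)"
    using k by (intro add_mono mult_right_mono) auto
  also have "\<dots> \<le> ?A * (2 * sqrt (lyapunov t))"
    unfolding distrib_left[symmetric] lyapunov_def using sqrt_two_add_le[OF k] A by (intro mult_left_mono) auto
  also have "\<dots> \<le> ?A * (2 * sqrt (exp (- c * t) * lyapunov 0))"
    using lyapunov_decay[OF t] A by (intro mult_left_mono) auto
  also have "sqrt (exp (- c * t) * lyapunov 0) = exp (- (\<sigma>\<^sup>2 / 4) * t) * sqrt (lyapunov 0)"
  proof -
    \<comment> \<open>The square root from Pinsker's inequality halves the decay rate.\<close>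
    have "exp (- c * t) = (exp (- (\<sigma>\<^sup>2 / 4) * t))\<^sup>2"
      by (simp add: power2_eq_square mult_exp_exp)
    then show ?thesis by (simp add: real_sqrt_mult)
  qed
  finally show ?thesis
    by (intro order_trans[OF nikaido_isoda_le[OF t A a b]]) (auto simp: mult_ac)
qed

end

end

theorem theorem2p3:
  fixes X Y :: "'a::euclidean_space set"
    and U\<^sub>\<pi> U\<^sub>\<rho> :: "'a \<Rightarrow> real"
    and F :: "'a measure \<Rightarrow> 'a measure \<Rightarrow> real"
    and \<sigma> :: real
    and F\<^sub>\<nu> F\<^sub>\<mu> :: "'a measure \<Rightarrow> 'a measure \<Rightarrow> 'a \<Rightarrow> real"
    and F\<^sub>\<nu>\<^sub>\<nu> F\<^sub>\<mu>\<^sub>\<mu> F\<^sub>\<nu>\<^sub>\<mu> F\<^sub>\<mu>\<^sub>\<nu> :: "'a measure \<Rightarrow> 'a measure \<Rightarrow> 'a \<Rightarrow> 'a \<Rightarrow> real"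
    and C\<^sub>\<nu> C\<^sub>\<mu> C\<^sub>\<nu>\<^sub>\<nu> C\<^sub>\<mu>\<^sub>\<mu> C\<^sub>\<nu>\<^sub>\<mu> C\<^sub>\<mu>\<^sub>\<nu> r\<^sub>\<nu> r\<^sub>\<mu> R\<^sub>\<nu> R\<^sub>\<mu> :: real
    and n m :: "real \<Rightarrow> 'a \<Rightarrow> real"
  defines "V \<equiv> game_value F (gibbs X U\<^sub>\<pi>) (gibbs Y U\<^sub>\<rho>) \<sigma>"
    and "a \<equiv> drift_a X U\<^sub>\<pi> F\<^sub>\<nu> \<sigma>"
    and "b \<equiv> drift_b Y U\<^sub>\<rho> F\<^sub>\<mu> \<sigma>"
    and "\<nu>t \<equiv> \<lambda>t. dens_meas X (n t)"
    and "\<mu>t \<equiv> \<lambda>t. dens_meas Y (m t)"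
  assumes "X \<in> sets borel" "Y \<in> sets borel"
    and "U\<^sub>\<pi> \<in> borel_measurable (restrict_space borel X)"
    and "U\<^sub>\<rho> \<in> borel_measurable (restrict_space borel Y)"
    and "prob_density_on X (gibbs_density X U\<^sub>\<pi>)"
    and "prob_density_on Y (gibbs_density Y U\<^sub>\<rho>)"
    and "\<sigma> > 0"
    \<comment> \<open>(i)\<close>
    and "\<And>\<mu>. \<mu> \<in> prob_on Y \<Longrightarrow> has_flat_derivative X (\<lambda>\<nu>. F \<nu> \<mu>) (\<lambda>\<nu>. F\<^sub>\<nu> \<nu> \<mu>)"
    and "\<And>\<nu>. \<nu> \<in> prob_on X \<Longrightarrow> has_flat_derivative Y (\<lambda>\<mu>. F \<nu> \<mu>) (\<lambda>\<mu>. F\<^sub>\<mu> \<nu> \<mu>)"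
    and "C\<^sub>\<nu> > 0" "C\<^sub>\<mu> > 0"
    and "\<And>\<nu> \<mu> x. \<nu> \<in> prob_on X \<Longrightarrow> \<mu> \<in> prob_on Y \<Longrightarrow> x \<in> X \<Longrightarrow> \<bar>F\<^sub>\<nu> \<nu> \<mu> x\<bar> \<le> C\<^sub>\<nu>"
    and "\<And>\<nu> \<mu> y. \<nu> \<in> prob_on X \<Longrightarrow> \<mu> \<in> prob_on Y \<Longrightarrow> y \<in> Y \<Longrightarrow> \<bar>F\<^sub>\<mu> \<nu> \<mu> y\<bar> \<le> C\<^sub>\<mu>"
    \<comment> \<open>(ii)\<close>
    and "\<And>\<mu> x. \<mu> \<in> prob_on Y \<Longrightarrow> x \<in> X \<Longrightarrow>
           has_flat_derivative X (\<lambda>\<nu>. F\<^sub>\<nu> \<nu> \<mu> x) (\<lambda>\<nu>. F\<^sub>\<nu>\<^sub>\<nu> \<nu> \<mu> x)"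
    and "\<And>\<nu> y. \<nu> \<in> prob_on X \<Longrightarrow> y \<in> Y \<Longrightarrow>
           has_flat_derivative Y (\<lambda>\<mu>. F\<^sub>\<mu> \<nu> \<mu> y) (\<lambda>\<mu>. F\<^sub>\<mu>\<^sub>\<mu> \<nu> \<mu> y)"
    and "\<And>\<mu> y. \<mu> \<in> prob_on Y \<Longrightarrow> y \<in> Y \<Longrightarrow>
           has_flat_derivative X (\<lambda>\<nu>. F\<^sub>\<mu> \<nu> \<mu> y) (\<lambda>\<nu>. F\<^sub>\<nu>\<^sub>\<mu> \<nu> \<mu> y)"
    and "\<And>\<nu> x. \<nu> \<in> prob_on X \<Longrightarrow> x \<in> X \<Longrightarrow>
           has_flat_derivative Y (\<lambda>\<mu>. F\<^sub>\<nu> \<nu> \<mu> x) (\<lambda>\<mu>. F\<^sub>\<mu>\<^sub>\<nu> \<nu> \<mu> x)"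
    and "C\<^sub>\<nu>\<^sub>\<nu> > 0" "C\<^sub>\<mu>\<^sub>\<mu> > 0" "C\<^sub>\<nu>\<^sub>\<mu> > 0" "C\<^sub>\<mu>\<^sub>\<nu> > 0"
    and "\<And>\<nu> \<mu> x x'. \<nu> \<in> prob_on X \<Longrightarrow> \<mu> \<in> prob_on Y \<Longrightarrow> x \<in> X \<Longrightarrow> x' \<in> X \<Longrightarrow>
           \<bar>F\<^sub>\<nu>\<^sub>\<nu> \<nu> \<mu> x x'\<bar> \<le> C\<^sub>\<nu>\<^sub>\<nu>"
    and "\<And>\<nu> \<mu> y y'. \<nu> \<in> prob_on X \<Longrightarrow> \<mu> \<in> prob_on Y \<Longrightarrow> y \<in> Y \<Longrightarrow> y' \<in> Y \<Longrightarrow>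
           \<bar>F\<^sub>\<mu>\<^sub>\<mu> \<nu> \<mu> y y'\<bar> \<le> C\<^sub>\<mu>\<^sub>\<mu>"
    and "\<And>\<nu> \<mu> x y. \<nu> \<in> prob_on X \<Longrightarrow> \<mu> \<in> prob_on Y \<Longrightarrow> x \<in> X \<Longrightarrow> y \<in> Y \<Longrightarrow>
           \<bar>F\<^sub>\<nu>\<^sub>\<mu> \<nu> \<mu> y x\<bar> \<le> C\<^sub>\<nu>\<^sub>\<mu>"
    and "\<And>\<nu> \<mu> x y. \<nu> \<in> prob_on X \<Longrightarrow> \<mu> \<in> prob_on Y \<Longrightarrow> x \<in> X \<Longrightarrow> y \<in> Y \<Longrightarrow>
           \<bar>F\<^sub>\<mu>\<^sub>\<nu> \<nu> \<mu> x y\<bar> \<le> C\<^sub>\<mu>\<^sub>\<nu>"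
    \<comment> \<open>the flow, and (iii) for its initial condition\<close>
    and "fisher_rao_flow X Y U\<^sub>\<pi> U\<^sub>\<rho> F\<^sub>\<nu> F\<^sub>\<mu> \<sigma> n m"
    and "r\<^sub>\<nu> > 0" "r\<^sub>\<mu> > 0" "R\<^sub>\<nu> > 1" "R\<^sub>\<mu> > 1"
    and "ereal r\<^sub>\<nu> \<le> (INF x\<in>X. ereal (n 0 x / gibbs_density X U\<^sub>\<pi> x))"
    and "(SUP x\<in>X. ereal (n 0 x / gibbs_density X U\<^sub>\<pi> x)) \<le> ereal R\<^sub>\<nu>"
    and "ereal r\<^sub>\<mu> \<le> (INF y\<in>Y. ereal (m 0 y / gibbs_density Y U\<^sub>\<rho> y))"
    and "(SUP y\<in>Y. ereal (m 0 y / gibbs_density Y U\<^sub>\<rho> y)) \<le> ereal R\<^sub>\<mu>"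
  shows
    "(\<forall>\<nu>\<in>prob_ac_on X. \<forall>\<mu>\<in>prob_ac_on Y.
        if KL \<nu> (\<nu>t 0) + KL \<mu> (\<mu>t 0) < \<infinity>
        then (\<forall>t\<ge>0. KL \<nu> (\<nu>t t) + KL \<mu> (\<mu>t t) < \<infinity>) \<and>
             (\<lambda>t. real_of_ereal (KL \<nu> (\<nu>t t) + KL \<mu> (\<mu>t t))) differentiable_on {0..}
        else (\<forall>t\<ge>0. KL \<nu> (\<nu>t t) + KL \<mu> (\<mu>t t) = \<infinity>)) \<and>
     (\<exists>C\<^sub>1>0. \<forall>t\<ge>0. \<forall>\<mu>\<in>prob_on Y. \<forall>x\<in>X. \<bar>a (n t) \<mu> x\<bar> \<le> C\<^sub>1) \<and>
     (\<exists>C\<^sub>2>0. \<forall>t\<ge>0. \<forall>\<nu>\<in>prob_on X. \<forall>y\<in>Y. \<bar>b \<nu> (m t) y\<bar> \<le> C\<^sub>2) \<and>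
     (convex_concave X Y F F\<^sub>\<nu> F\<^sub>\<mu> \<longrightarrow>
       (\<forall>\<nu>s \<mu>s. mixed_nash X Y V \<nu>s \<mu>s \<longrightarrow>
          KL \<nu>s (\<nu>t 0) + KL \<mu>s (\<mu>t 0) < \<infinity> \<and>
          (\<forall>t>0. KL \<nu>s (\<nu>t t) + KL \<mu>s (\<mu>t t)
             \<le> ereal (exp (- (\<sigma>\<^sup>2 / 2) * t)) * (KL \<nu>s (\<nu>t 0) + KL \<mu>s (\<mu>t 0))) \<and>
          (\<forall>C\<^sub>1>0. \<forall>C\<^sub>2>0.
             (\<forall>t\<ge>0. \<forall>\<mu>\<in>prob_on Y. \<forall>x\<in>X. \<bar>a (n t) \<mu> x\<bar> \<le> C\<^sub>1) \<longrightarrow>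
             (\<forall>t\<ge>0. \<forall>\<nu>\<in>prob_on X. \<forall>y\<in>Y. \<bar>b \<nu> (m t) y\<bar> \<le> C\<^sub>2) \<longrightarrow>
             (\<forall>t>0. nikaido_isoda X Y V (\<nu>t t) (\<mu>t t)
                \<le> ereal (2 * max C\<^sub>1 C\<^sub>2 * exp (- (\<sigma>\<^sup>2 / 4) * t)
                    * sqrt (real_of_ereal (KL \<nu>s (\<nu>t 0) + KL \<mu>s (\<mu>t 0))))))))"
proof -
  have gibbs: "prob_density_on X (gibbs_density X U\<^sub>\<pi>)" "prob_density_on Y (gibbs_density Y U\<^sub>\<rho>)"
    by fact+
  have ratio: "\<And>x. x \<in> X \<Longrightarrow> r\<^sub>\<nu> \<le> n 0 x / gibbs_density X U\<^sub>\<pi> x"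
    "\<And>x. x \<in> X \<Longrightarrow> n 0 x / gibbs_density X U\<^sub>\<pi> x \<le> R\<^sub>\<nu>"
    "\<And>y. y \<in> Y \<Longrightarrow> r\<^sub>\<mu> \<le> m 0 y / gibbs_density Y U\<^sub>\<rho> y"
    "\<And>y. y \<in> Y \<Longrightarrow> m 0 y / gibbs_density Y U\<^sub>\<rho> y \<le> R\<^sub>\<mu>"
    using \<open>ereal r\<^sub>\<nu> \<le> _\<close> \<open>ereal r\<^sub>\<mu> \<le> _\<close> \<open>_ \<le> ereal R\<^sub>\<nu>\<close> \<open>_ \<le> ereal R\<^sub>\<mu>\<close>
    by (simp_all add: le_INF_iff SUP_le_iff)
  interpret fisher_rao_game X Y U\<^sub>\<pi> U\<^sub>\<rho> F \<sigma> F\<^sub>\<nu> F\<^sub>\<mu> C\<^sub>\<nu> C\<^sub>\<mu> r\<^sub>\<nu> r\<^sub>\<mu> R\<^sub>\<nu> R\<^sub>\<mu> n m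
    by (unfold_locales; (fact | rule ratio; assumption))
  show ?thesis
    unfolding V_def a_def b_def \<nu>t_def \<mu>t_def
  proof (intro conjI ballI impI allI)
    show "if KL \<nu> (x.N 0) + KL \<mu> (y.N 0) < \<infinity>
        then (\<forall>t\<ge>0. KL \<nu> (x.N t) + KL \<mu> (y.N t) < \<infinity>) \<and>
          (\<lambda>t. real_of_ereal (KL \<nu> (x.N t) + KL \<mu> (y.N t))) differentiable_on {0..}
        else (\<forall>t\<ge>0. KL \<nu> (x.N t) + KL \<mu> (y.N t) = \<infinity>)"
      if "\<nu> \<in> prob_ac_on X" "\<mu> \<in> prob_ac_on Y" for \<nu> \<mu>
      using that by (intro KL_sum_dichotomy) (simp_all add: prob_ac_on_def)
    fix \<nu>s \<mu>s
    assume cc: "convex_concave X Y F F\<^sub>\<nu> F\<^sub>\<mu>"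
      and nash: "mixed_nash X Y (game_value F (gibbs X U\<^sub>\<pi>) (gibbs Y U\<^sub>\<rho>) \<sigma>) \<nu>s \<mu>s"
    \<comment> \<open>At an equilibrium the sum of divergences is a real number at every nonnegative
      time, so the extended-real claims reduce to real ones.\<close>
    note sum_eq = KL_sum_eq[OF cc nash]
    show "KL \<nu>s (x.N 0) + KL \<mu>s (y.N 0) < \<infinity>" by (simp add: sum_eq)
    show "KL \<nu>s (x.N t) + KL \<mu>s (y.N t)
        \<le> ereal (exp (- (\<sigma>\<^sup>2 / 2) * t)) * (KL \<nu>s (x.N 0) + KL \<mu>s (y.N 0))" if "0 < t" for t
      using lyapunov_decay[OF cc nash, of t] that by (simp add: sum_eq)
    show "nikaido_isoda X Y (game_value F (gibbs X U\<^sub>\<pi>) (gibbs Y U\<^sub>\<rho>) \<sigma>) (x.N t) (y.N t) \<le> ereal (2 * max C\<^sub>1 C\<^sub>2 * exp (- (\<sigma>\<^sup>2 / 4) * t)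
        * sqrt (real_of_ereal (KL \<nu>s (x.N 0) + KL \<mu>s (y.N 0))))"
      if "0 < C\<^sub>1" "0 < C\<^sub>2"
        "\<forall>t\<ge>0. \<forall>\<mu>\<in>prob_on Y. \<forall>x\<in>X. \<bar>drift_a X U\<^sub>\<pi> F\<^sub>\<nu> \<sigma> (n t) \<mu> x\<bar> \<le> C\<^sub>1"
        "\<forall>t\<ge>0. \<forall>\<nu>\<in>prob_on X. \<forall>y\<in>Y. \<bar>drift_b Y U\<^sub>\<rho> F\<^sub>\<mu> \<sigma> \<nu> (m t) y\<bar> \<le> C\<^sub>2"
        "0 < t" for C\<^sub>1 C\<^sub>2 t
      using nikaido_isoda_decay[OF cc nash _ that(1,2), of t] that by (simp add: sum_eq)
  qed (rule drift_a_bounded drift_b_bounded)+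
qed

end
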